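(* Let $G$ be a Banach--Lie group and let $H$ be a proper closed subgroup of $G$, equipped with the subspace topology. Then the inclusion $H\to G$ is not an epimorphism in the category of Hausdorff topological groups; that is, there exist a Hausdorff topological group $K$ and two distinct continuous homomorphisms $\varphi,\psi:G\to K$ that agree on $H$.
   Context: A Banach--Lie group is a real Lie group in the sense of Bourbaki, i.e. a group that is a (real analytic) manifold modelled on a real Banach space with (analytic) smooth group operations. The closed subgroup $H$ is not assumed to be a Lie subgroup, and $G$ is not assumed to be connected. Morphisms in the category of Hausdorff topological groups are continuous homomorphisms. A morphism $f:A\to B$ in a category is an epimorphism if for any object $Z$ and any morphisms $g_1,g_2:B\to Z$, the equality $g_1f=g_2f$ implies $g_1=g_2$. *)

theory Defs
  imports "HOL-Analysis.Analysis" "HOL-Algebra.Group"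
begin

section \<open>Analytic maps between Banach spaces\<close>

text \<open>
  A continuous \<open>k\<close>-linear map is a function of sequences that only reads the entries with
  index below \<open>k\<close>; this keeps \<open>k\<close> a variable of the logic.
\<close>

definition continuous_multilinear ::
    "nat \<Rightarrow> ((nat \<Rightarrow> 'a::real_normed_vector) \<Rightarrow> 'b::real_normed_vector) \<Rightarrow> bool" where
  "continuous_multilinear k u \<longleftrightarrow>
     (\<forall>x y. (\<forall>i<k. x i = y i) \<longrightarrow> u x = u y) \<and>
     (\<forall>x. \<forall>i<k. linear (\<lambda>t. u (x(i := t)))) \<and>
     (\<exists>C. \<forall>x. norm (u x) \<le> C * (\<Prod>i<k. norm (x i)))"

definition continuous_homogeneous_polynomial ::
    "nat \<Rightarrow> ('a::real_normed_vector \<Rightarrow> 'b::real_normed_vector) \<Rightarrow> bool" where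
  "continuous_homogeneous_polynomial k p \<longleftrightarrow>
     (\<exists>u. continuous_multilinear k u \<and> (\<forall>h. p h = u (\<lambda>_. h)))"

text \<open>
  Around each point of \<open>U\<close> the map is the sum of a convergent power series of continuous
  homogeneous polynomials, normally convergent on a ball contained in \<open>U\<close>. In particular
  \<open>U\<close> is open.
\<close>

definition real_analytic_on ::
    "('a::real_normed_vector \<Rightarrow> 'b::real_normed_vector) \<Rightarrow> 'a set \<Rightarrow> bool" where
  "real_analytic_on f U \<longleftrightarrow>
     (\<forall>a\<in>U. \<exists>(p :: nat \<Rightarrow> 'a \<Rightarrow> 'b) (c :: nat \<Rightarrow> real) r. 0 < r \<and>
        (\<forall>k. continuous_homogeneous_polynomial k (p k)) \<and>
        (\<forall>k h. norm (p k h) \<le> c k * norm h ^ k) \<and>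
        summable (\<lambda>k. c k * r ^ k) \<and>
        (\<forall>h. norm h < r \<longrightarrow> a + h \<in> U \<and> (\<lambda>k. p k h) sums f (a + h)))"


section \<open>Analytic Banach manifolds\<close>

text \<open>
  A chart is a domain together with a map that is relevant on that domain only. The model
  space is the whole type \<open>'e\<close>; neither connectedness nor a countability condition is imposed.
\<close>

type_synonym ('m, 'e) chart = "'m set \<times> ('m \<Rightarrow> 'e)"

definition is_chart :: "'m topology \<Rightarrow> ('m, 'e::real_normed_vector) chart \<Rightarrow> bool" where
  "is_chart T = (\<lambda>(U, \<phi>).
     openin T U \<and> open (\<phi> ` U) \<and>
     homeomorphic_map (subtopology T U) (top_of_set (\<phi> ` U)) \<phi>)"

definition analytic_manifold ::
    "'m topology \<Rightarrow> ('m, 'e::banach) chart set \<Rightarrow> bool" where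
  "analytic_manifold T A \<longleftrightarrow>
     Hausdorff_space T \<and>
     (\<forall>c\<in>A. is_chart T c) \<and>
     (\<Union>(U, \<phi>)\<in>A. U) = topspace T \<and>
     (\<forall>(U, \<phi>)\<in>A. \<forall>(V, \<psi>)\<in>A. real_analytic_on (\<psi> \<circ> inv_into U \<phi>) (\<phi> ` (U \<inter> V)))"

definition product_atlas ::
    "('m, 'e) chart set \<Rightarrow> ('n, 'f) chart set \<Rightarrow> ('m \<times> 'n, 'e \<times> 'f) chart set" where
  "product_atlas A B = {(U \<times> V, map_prod \<phi> \<psi>) |U \<phi> V \<psi>. (U, \<phi>) \<in> A \<and> (V, \<psi>) \<in> B}"

definition analytic_map ::
    "'m topology \<Rightarrow> ('m, 'e::real_normed_vector) chart set \<Rightarrow>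
     'n topology \<Rightarrow> ('n, 'f::real_normed_vector) chart set \<Rightarrow> ('m \<Rightarrow> 'n) \<Rightarrow> bool" where
  "analytic_map S A T B f \<longleftrightarrow>
     continuous_map S T f \<and>
     (\<forall>(U, \<phi>)\<in>A. \<forall>(V, \<psi>)\<in>B.
        real_analytic_on (\<psi> \<circ> f \<circ> inv_into U \<phi>) (\<phi> ` (U \<inter> f -` V)))"


section \<open>Banach--Lie groups\<close>

definition banach_lie_group ::
    "('g, 'x) monoid_scheme \<Rightarrow> 'g topology \<Rightarrow> ('g, 'e::banach) chart set \<Rightarrow> bool" where
  "banach_lie_group G T A \<longleftrightarrow>
     group G \<and> topspace T = carrier G \<and> analytic_manifold T A \<and>
     analytic_map (prod_topology T T) (product_atlas A A) T A (\<lambda>(x, y). x \<otimes>\<^bsub>G\<^esub> y) \<and>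
     analytic_map T A T A (\<lambda>x. inv\<^bsub>G\<^esub> x)"


section \<open>Hausdorff topological groups and their epimorphisms\<close>

definition hausdorff_group :: "('g, 'x) monoid_scheme \<Rightarrow> 'g topology \<Rightarrow> bool" where
  "hausdorff_group G T \<longleftrightarrow>
     group G \<and> topspace T = carrier G \<and> Hausdorff_space T \<and>
     continuous_map (prod_topology T T) T (\<lambda>(x, y). x \<otimes>\<^bsub>G\<^esub> y) \<and>
     continuous_map T T (\<lambda>x. inv\<^bsub>G\<^esub> x)"

definition hausdorff_group_hom ::
    "('a, 'x) monoid_scheme \<Rightarrow> 'a topology \<Rightarrow> ('b, 'y) monoid_scheme \<Rightarrow> 'b topology \<Rightarrow>
     ('a \<Rightarrow> 'b) \<Rightarrow> bool" where
  "hausdorff_group_hom A S B T f \<longleftrightarrow>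
     hausdorff_group A S \<and> hausdorff_group B T \<and> f \<in> hom A B \<and> continuous_map S T f"

text \<open>
  The test objects \<open>Z\<close> range over the groups with carrier in a given type, since types cannot
  be quantified in a formula.
\<close>

definition hausdorff_group_epi ::
    "'z itself \<Rightarrow> ('a, 'x) monoid_scheme \<Rightarrow> 'a topology \<Rightarrow>
     ('b, 'y) monoid_scheme \<Rightarrow> 'b topology \<Rightarrow> ('a \<Rightarrow> 'b) \<Rightarrow> bool" where
  "hausdorff_group_epi _ A S B T f \<longleftrightarrow>
     hausdorff_group_hom A S B T f \<and>
     (\<forall>(Z :: 'z monoid) R g1 g2.
        hausdorff_group_hom B T Z R g1 \<longrightarrow> hausdorff_group_hom B T Z R g2 \<longrightarrow>
        (\<forall>a\<in>carrier A. g1 (f a) = g2 (f a)) \<longrightarrow> (\<forall>b\<in>carrier B. g1 b = g2 b))"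

text \<open>
  Two homomorphisms out of \<open>B\<close> may be corestricted to the subgroup generated by their images,
  whose elements are values of words in two copies of \<open>B\<close>. An element is represented by the
  set of words evaluating to it. Hence groups carried by this type already decide whether a
  morphism into \<open>B\<close> is an epimorphism (\<open>hausdorff_group_epi_universal\<close>).
\<close>

type_synonym 'b words = "(bool \<times> 'b) list set"

lemma hausdorff_group_transport:
  fixes Z :: "('z, 'x) monoid_scheme" and c :: "'z \<Rightarrow> 'k"
  assumes Z: "hausdorff_group Z R" and S: "subgroup S Z" and c: "inj_on c S"
  obtains K :: "'k monoid" and Q
  where "hausdorff_group K Q"
    and "\<And>(B :: ('b, 'y) monoid_scheme) T g. hausdorff_group_hom B T Z R g \<Longrightarrow>
           g ` carrier B \<subseteq> S \<Longrightarrow> hausdorff_group_hom B T K Q (c \<circ> g)"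
proof -
  define d where "d = inv_into S c"
  define K where "K = \<lparr>carrier = c ` S, mult = (\<lambda>a b. c (d a \<otimes>\<^bsub>Z\<^esub> d b)), one = c \<one>\<^bsub>Z\<^esub>\<rparr>"
  define Q where "Q = pullback_topology (c ` S) d R"
  interpret Z: group Z using Z by (simp add: hausdorff_group_def)
  interpret S: subgroup S Z by (rule S)
  have tR: "topspace R = carrier Z" and hR: "Hausdorff_space R"
    and mR: "continuous_map (prod_topology R R) R (\<lambda>(x, y). x \<otimes>\<^bsub>Z\<^esub> y)"
    and iR: "continuous_map R R (\<lambda>x. inv\<^bsub>Z\<^esub> x)"
    using Z by (auto simp: hausdorff_group_def)
  have dc [simp]: "d (c s) = s" if "s \<in> S" for s
    using c that by (simp add: d_def)
  have K_simps: "carrier K = c ` S" "a \<otimes>\<^bsub>K\<^esub> b = c (d a \<otimes>\<^bsub>Z\<^esub> d b)" "\<one>\<^bsub>K\<^esub> = c \<one>\<^bsub>Z\<^esub>" for a b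
    by (simp_all add: K_def)
  have K: "group K"
  proof (rule groupI)
    fix x assume "x \<in> carrier K"
    then obtain s where s: "s \<in> S" "x = c s" by (auto simp: K_simps)
    then show "\<exists>y\<in>carrier K. y \<otimes>\<^bsub>K\<^esub> x = \<one>\<^bsub>K\<^esub>"
      by (intro bexI[of _ "c (inv\<^bsub>Z\<^esub> s)"]) (auto simp: K_simps)
  qed (auto simp: K_simps Z.m_assoc)
  have inv_K: "inv\<^bsub>K\<^esub> (c s) = c (inv\<^bsub>Z\<^esub> s)" if "s \<in> S" for s
    by (rule group.inv_equality[OF K]) (use that in \<open>auto simp: K_simps\<close>)
  have tQ: "topspace Q = c ` S"
    by (auto simp: Q_def topspace_pullback_topology tR)
  have dcont: "continuous_map Q R d"
    using continuous_map_pullback[OF continuous_map_id, of "c ` S" d R] by (simp add: Q_def)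
  have into: "continuous_map X Q f" if "continuous_map X R (d \<circ> f)" "f ` topspace X \<subseteq> c ` S" for X :: "'u topology" and f
    unfolding Q_def by (rule continuous_map_pullback') (use that in auto)
  have hQ: "Hausdorff_space Q"
    by (rule Hausdorff_space_injective_preimage[OF hR dcont])
       (auto simp: tQ inj_on_def)
  have mQ: "continuous_map (prod_topology Q Q) Q (\<lambda>(x, y). x \<otimes>\<^bsub>K\<^esub> y)"
  proof (rule into)
    have "continuous_map (prod_topology Q Q) (prod_topology R R) (\<lambda>(x, y). (d x, d y))"
      using dcont by (simp add: continuous_map_prod_top)
    from continuous_map_compose[OF this mR]
    show "continuous_map (prod_topology Q Q) R (d \<circ> (\<lambda>(x, y). x \<otimes>\<^bsub>K\<^esub> y))"
      by (rule continuous_map_eq) (auto simp: tQ K_simps)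
  qed (auto simp: tQ K_simps)
  have iQ: "continuous_map Q Q (\<lambda>x. inv\<^bsub>K\<^esub> x)"
  proof (rule into)
    show "continuous_map Q R (d \<circ> (\<lambda>x. inv\<^bsub>K\<^esub> x))"
      using continuous_map_compose[OF dcont iR]
      by (rule continuous_map_eq) (auto simp: tQ inv_K)
  qed (auto simp: tQ inv_K)
  have KQ: "hausdorff_group K Q"
    using K tQ hQ mQ iQ by (simp add: hausdorff_group_def K_simps)
  show thesis
  proof (rule that[OF KQ])
    fix B :: "('b, 'y) monoid_scheme" and T g
    assume g: "hausdorff_group_hom B T Z R g" and gS: "g ` carrier B \<subseteq> S"
    then have tB: "topspace T = carrier B"
      by (simp add: hausdorff_group_hom_def hausdorff_group_def)
    have "continuous_map T R (d \<circ> (c \<circ> g))"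
      by (rule continuous_map_eq[of _ _ g])
         (use g gS tB in \<open>auto simp: hausdorff_group_hom_def\<close>)
    then have "continuous_map T Q (c \<circ> g)"
      by (rule into) (use gS tB in auto)
    moreover have "c \<circ> g \<in> hom B K"
      using g gS by (auto simp: hausdorff_group_hom_def hom_def K_simps image_subset_iff)
    ultimately show "hausdorff_group_hom B T K Q (c \<circ> g)"
      using g KQ by (simp add: hausdorff_group_hom_def)
  qed
qed

lemma hausdorff_group_epi_universal:
  fixes A :: "('a, 'x) monoid_scheme" and B :: "('b, 'y) monoid_scheme"
  assumes epi: "hausdorff_group_epi TYPE('b words) A S B T f"
  shows "hausdorff_group_epi TYPE('z) A S B T f"
  unfolding hausdorff_group_epi_def
proof (intro conjI allI impI ballI)
  show f: "hausdorff_group_hom A S B T f"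
    using epi by (simp add: hausdorff_group_epi_def)
  fix Z :: "'z monoid" and R g1 g2 b
  assume g1: "hausdorff_group_hom B T Z R g1" and g2: "hausdorff_group_hom B T Z R g2"
    and eq: "\<forall>a\<in>carrier A. g1 (f a) = g2 (f a)" and b: "b \<in> carrier B"
  have ZR: "hausdorff_group Z R" and hom: "g1 \<in> hom B Z" "g2 \<in> hom B Z" and "group B"
    using g1 g2 by (auto simp: hausdorff_group_hom_def hausdorff_group_def)
  interpret Z: group Z using ZR by (simp add: hausdorff_group_def)
  interpret g1: group_hom B Z g1
    using hom \<open>group B\<close> by (simp add: group_hom_def group_hom_axioms_def Z.group_axioms)
  interpret g2: group_hom B Z g2
    using hom \<open>group B\<close> by (simp add: group_hom_def group_hom_axioms_def Z.group_axioms)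
  define L where "L = lists ((UNIV :: bool set) \<times> carrier B)"
  define ev where "ev w = foldr (\<lambda>(i, x) z. (if i then g1 x else g2 x) \<otimes>\<^bsub>Z\<^esub> z) w \<one>\<^bsub>Z\<^esub>"
    for w :: "(bool \<times> 'b) list"
  have ev_Nil [simp]: "ev [] = \<one>\<^bsub>Z\<^esub>"
    and ev_Cons [simp]: "ev ((i, x) # w) = (if i then g1 x else g2 x) \<otimes>\<^bsub>Z\<^esub> ev w" for i x w
    by (simp_all add: ev_def)
  have ev_carrier [simp]: "ev w \<in> carrier Z" if "w \<in> L" for w
    using that unfolding L_def by (induction w) auto
  have ev_append: "ev (v @ w) = ev v \<otimes>\<^bsub>Z\<^esub> ev w" if "v \<in> L" "w \<in> L" for v w
    using that(1)
    unfolding L_def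
  proof (induction v)
    case (Cons p v)
    then show ?case
      using that(2) ev_carrier[of v] ev_carrier[of w] by (cases p) (auto simp: Z.m_assoc L_def)
  qed (use that in auto)
  have ev_inv: "\<exists>v\<in>L. ev v = inv\<^bsub>Z\<^esub> (ev w)" if "w \<in> L" for w
    using that unfolding L_def
  proof (induction w)
    case Nil
    then show ?case by (intro bexI[of _ "[]"]) auto
  next
    case (Cons p w)
    obtain i x where p: "p = (i, x)" by (cases p)
    obtain v where v: "v \<in> L" "ev v = inv\<^bsub>Z\<^esub> (ev w)"
      using Cons.IH by (auto simp: L_def)
    have x: "x \<in> carrier B" and w: "w \<in> L" using Cons.hyps p by (auto simp: L_def)
    have q: "[(i, inv\<^bsub>B\<^esub> x)] \<in> L" using x by (simp add: L_def)
    have "ev (v @ [(i, inv\<^bsub>B\<^esub> x)]) = inv\<^bsub>Z\<^esub> (ev (p # w))"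
      using x w v q by (simp add: ev_append p Z.inv_mult_group)
    moreover have "v @ [(i, inv\<^bsub>B\<^esub> x)] \<in> L" using v q by (simp add: L_def)
    ultimately show ?case unfolding L_def by blast
  qed
  have sub: "subgroup (ev ` L) Z"
  proof
    show "\<one>\<^bsub>Z\<^esub> \<in> ev ` L" by (rule image_eqI[of _ _ "[]"]) (auto simp: L_def)
    show "x \<otimes>\<^bsub>Z\<^esub> y \<in> ev ` L" if xy: "x \<in> ev ` L" "y \<in> ev ` L" for x y
    proof -
      obtain v w where "v \<in> L" "w \<in> L" "x = ev v" "y = ev w" using xy by blast
      then show ?thesis
        by (intro image_eqI[of _ _ "v @ w"]) (auto simp: ev_append, simp add: L_def)
    qed
    show "inv\<^bsub>Z\<^esub> x \<in> ev ` L" if x: "x \<in> ev ` L" for x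
    proof -
      obtain w where "w \<in> L" "x = ev w" using x by blast
      with ev_inv[of w] show ?thesis by force
    qed
  qed auto
  define c where "c z = {w \<in> L. ev w = z}" for z
  have c: "inj_on c (ev ` L)" by (auto simp: inj_on_def c_def)
  have "g1 x \<in> ev ` L" "g2 x \<in> ev ` L" if "x \<in> carrier B" for x
  proof -
    have "g1 x = ev [(True, x)]" "g2 x = ev [(False, x)]"
         "[(True, x)] \<in> L" "[(False, x)] \<in> L"
      using that by (auto simp: L_def)
    then show "g1 x \<in> ev ` L" "g2 x \<in> ev ` L" by blast+
  qed
  then have im: "g1 ` carrier B \<subseteq> ev ` L" "g2 ` carrier B \<subseteq> ev ` L"
    by blast+
  obtain K :: "'b words monoid" and Q where
    K: "\<And>(B :: ('b, 'y) monoid_scheme) T g. hausdorff_group_hom B T Z R g \<Longrightarrow>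
          g ` carrier B \<subseteq> ev ` L \<Longrightarrow> hausdorff_group_hom B T K Q (c \<circ> g)"
    using hausdorff_group_transport[OF ZR sub c, where ?'b = 'b and ?'y = 'y] by metis
  have "hausdorff_group_hom B T K Q (c \<circ> g1)" "hausdorff_group_hom B T K Q (c \<circ> g2)"
    by (rule K; use g1 g2 im in simp)+
  moreover have "\<forall>a\<in>carrier A. (c \<circ> g1) (f a) = (c \<circ> g2) (f a)"
    using eq by simp
  ultimately have "(c \<circ> g1) b = (c \<circ> g2) b"
    using epi b unfolding hausdorff_group_epi_def by blast
  then show "g1 b = g2 b"
    using inj_onD[OF c] im b by (simp add: image_subset_iff)
qed

end

theory Submission
  imports Defs "HOL-Computational_Algebra.Polynomial"
begin

text \<open>
  If \<open>G\<close> acts continuously by automorphisms on a Hausdorff group \<open>F\<close> and some \<open>f\<close> in \<open>F\<close> is fixed by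
  \<open>H\<close> but not by \<open>G\<close>, then the inclusion of \<open>G\<close> into the semidirect product of \<open>F\<close> and \<open>G\<close> and its
  conjugate by \<open>f\<close> agree on \<open>H\<close> and differ. For \<open>F\<close> one takes functionals on the Lipschitz functions
  on \<open>G / H\<close> and for \<open>f\<close> the evaluation at the base point. The metric on \<open>G / H\<close> comes from a right
  invariant one on \<open>G\<close>, so that \<open>f\<close> has a continuous orbit. Left translation by \<open>g\<close> distorts it
  by at most the Lipschitz constant at the unit of conjugation by \<open>g\<close>, which in a Banach--Lie group
  is locally bounded in \<open>g\<close>: this makes the action jointly continuous. The
  only consequence of analyticity that is needed is that multiplication is locally Lipschitz in charts.
\<close>

section \<open>Local Lipschitz continuity of analytic maps\<close>

text \<open>Invariance pulls in two directions. Passing to cosets and continuity of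
  \<open>g \<mapsto> u g\<close> ask for increments \<open>u (z \<otimes> x) - u x\<close>
  controlled by \<open>z\<close> alone, hence for right invariance; but then left translation by
  \<open>g\<close> turns \<open>z\<close> into its conjugate by \<open>g\<close>, and for a general
  Hausdorff group nothing bounds this distortion for all elements near a given \<open>g\<close>.
  Lipschitz estimates for multiplication near the unit and near the pair of \<open>g\<close> and its
  inverse do.

  The Lipschitz estimate is obtained without differentiation. A homogeneous polynomial is bounded at
  real points only, so its increment along a line is read off from its values at equally spaced
  nodes. This costs a factor \<open>8 ^ k\<close> in degree \<open>k\<close>, which a ball of one
  eighth of the radius absorbs.\<close>

fun forward_difference :: "nat \<Rightarrow> (nat \<Rightarrow> 'a::real_vector) \<Rightarrow> 'a" where
  "forward_difference 0 q = q 0"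
| "forward_difference (Suc j) q = forward_difference j (\<lambda>n. q (Suc n) - q n)"

lemma forward_difference_add:
  "forward_difference j (\<lambda>n. q n + r n) = forward_difference j q + forward_difference j r"
proof (induction j arbitrary: q r)
  case (Suc j)
  show ?case using Suc[of "\<lambda>n. q (Suc n) - q n" "\<lambda>n. r (Suc n) - r n"]
    by (simp add: algebra_simps)
qed simp

lemma forward_difference_scaleR:
  "forward_difference j (\<lambda>n. f n *\<^sub>R a) = forward_difference j f *\<^sub>R a"
proof (induction j arbitrary: f)
  case (Suc j)
  show ?case using Suc[of "\<lambda>n. f (Suc n) - f n"] by (simp add: scaleR_diff_left)
qed simp

lemma forward_difference_0 [simp]: "forward_difference j (\<lambda>n. 0) = 0"
  by (induction j) auto

lemma forward_difference_sum:
  "forward_difference j (\<lambda>n. \<Sum>i\<in>I. f i n) = (\<Sum>i\<in>I. forward_difference j (f i))"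
  by (induction I rule: infinite_finite_induct) (simp_all add: forward_difference_add)

lemma norm_forward_difference_le:
  assumes "\<And>n. n \<le> j \<Longrightarrow> norm (q n) \<le> M"
  shows "norm (forward_difference j q :: 'a::real_normed_vector) \<le> 2 ^ j * M"
  using assms
proof (induction j arbitrary: q M)
  case (Suc j)
  have "norm (q (Suc n) - q n) \<le> 2 * M" if "n \<le> j" for n
    using Suc.prems[of n] Suc.prems[of "Suc n"] norm_triangle_ineq4[of "q (Suc n)" "q n"] that by linarith
  from Suc.IH[OF this] show ?case by (simp add: mult_ac)
qed simp

text \<open>Newton's forward formula. The induction hypothesis is used for \<open>q\<close> and for
  its difference sequence; Pascal's rule merges the two sums.\<close>

lemma newton_forward_difference_nat:
  "q n = (\<Sum>j\<le>n. real (n choose j) *\<^sub>R forward_difference j q)"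
proof (induction n arbitrary: q)
  case (Suc n)
  let ?D = "\<lambda>j. forward_difference j q"
  have "q (Suc n) = q n + (q (Suc n) - q n)" by simp
  also have "q (Suc n) - q n = (\<Sum>j\<le>n. real (n choose j) *\<^sub>R ?D (Suc j))"
    using Suc[of "\<lambda>n. q (Suc n) - q n"] by simp
  also have "q n = (\<Sum>j\<le>Suc n. real (n choose j) *\<^sub>R ?D j)"
    using Suc[of q] by simp
  also have "\<dots> = q 0 + (\<Sum>j\<le>n. real (n choose Suc j) *\<^sub>R ?D (Suc j))"
    by (subst sum.atMost_Suc_shift) simp
  finally show ?case
    by (subst sum.atMost_Suc_shift) (simp add: sum.distrib algebra_simps)
qed simp

text \<open>Both sides are polynomials in \<open>t\<close> of degree at most \<open>k\<close>, and
  they agree at the \<open>k + 1\<close> integers \<open>0, \<dots>, k\<close>. The coefficients do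
  not depend on \<open>t\<close>, so the identity passes to vector-valued polynomials by
  linearity.\<close>

lemma newton_forward_difference_power:
  assumes "i \<le> k"
  shows "t ^ i = (\<Sum>j\<le>k. (t gchoose j) * forward_difference j (\<lambda>n. real n ^ i))"
proof -
  define B where "B j = smult (1 / fact j) (\<Prod>l<j. [:- real l, 1:])" for j
  define P where "P = (\<Sum>j\<le>k. smult (forward_difference j (\<lambda>n. real n ^ i)) (B j)) - monom 1 i"
  have B: "poly (B j) t = t gchoose j" for j t
    by (simp add: B_def gbinomial_prod_rev poly_prod atLeast0LessThan)
  have P: "poly P t = (\<Sum>j\<le>k. (t gchoose j) * forward_difference j (\<lambda>n. real n ^ i)) - t ^ i" for t
    by (simp add: P_def poly_sum B poly_monom mult.commute)
  have "degree (B j) \<le> j" for j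
    unfolding B_def using degree_prod_sum_le[of "{..<j}" "\<lambda>l. [:- real l, 1:]"]
    by (simp add: degree_smult_le[THEN order_trans])
  then have "degree P \<le> k"
    unfolding P_def using assms
    by (intro degree_diff_le degree_sum_le)
       (auto intro: order_trans[OF degree_smult_le] order_trans degree_monom_le)
  moreover have "poly P (real n) = 0" if "n \<le> k" for n
  proof -
    have "(\<Sum>j\<le>k. (real n gchoose j) * forward_difference j (\<lambda>n. real n ^ i))
        = (\<Sum>j\<le>n. (real n gchoose j) * forward_difference j (\<lambda>n. real n ^ i))"
      using that by (intro sum.mono_neutral_right) (auto simp: binomial_gbinomial[symmetric])
    \<comment> \<open>The sum could be cut off at \<open>n\<close> because \<open>n choose j\<close>
      vanishes for \<open>j > n\<close>; what is left is the formula at natural arguments.\<close>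
    also have "\<dots> = real n ^ i"
      using newton_forward_difference_nat[of "\<lambda>n. real n ^ i" n]
      by (simp add: binomial_gbinomial)
    finally show ?thesis by (simp add: P)
  qed
  then have "real ` {..k} \<subseteq> {x. poly P x = 0}" by auto
  then have "card (real ` {..k}) \<le> degree P" if "P \<noteq> 0"
    using card_mono[OF poly_roots_finite[OF that], of "real ` {..k}"] card_poly_roots_bound[OF that]
    by linarith
  moreover have "card (real ` {..k}) = Suc k" by (simp add: card_image)
  ultimately have "P = 0" by linarith
  then show ?thesis using P[of t] by simp
qed

text \<open>Passing from one coefficient to the next multiplies by
  \<open>(t - (j + 1)) / (j + 2)\<close>, of absolute value at most \<open>1\<close>, and the first
  coefficient is \<open>t\<close>. The bound by \<open>t\<close>, not merely by a constant, is what
  makes increments linear in the distance.\<close>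

lemma abs_gbinomial_le:
  assumes "0 \<le> t" "t \<le> 1"
  shows "\<bar>t gchoose Suc j\<bar> \<le> (t::real)"
proof (induction j)
  case (Suc j)
  have "t gchoose Suc (Suc j) = (t gchoose Suc j) * ((t - real (Suc j)) / real (Suc (Suc j)))"
    using gbinomial_absorption[of "Suc j" t] gbinomial_absorb_comp[of t "Suc j"]
    by (simp add: field_simps)
  moreover have "\<bar>(t - real (Suc j)) / real (Suc (Suc j))\<bar> \<le> 1"
    using assms by (simp add: divide_simps)
  ultimately show ?case
    using mult_mono[OF Suc, of "\<bar>(t - real (Suc j)) / real (Suc (Suc j))\<bar>" 1] assms
    by (simp only: abs_mult) simp
qed (use assms in simp)

text \<open>By Newton interpolation at the nodes \<open>0, \<dots>, k\<close>.\<close>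
lemma norm_vector_polynomial_increment_le:
  fixes q :: "real \<Rightarrow> 'a::real_normed_vector"
  assumes q: "\<And>t. q t = (\<Sum>i\<le>k. t ^ i *\<^sub>R a i)"
    and M: "\<And>n. n \<le> k \<Longrightarrow> norm (q (real n)) \<le> M" and t: "0 \<le> t" "t \<le> 1"
  shows "norm (q t - q 0) \<le> t * 2 ^ Suc k * M"
proof -
  let ?D = "\<lambda>j. forward_difference j (\<lambda>n. q (real n))"
  have D: "?D j = (\<Sum>i\<le>k. forward_difference j (\<lambda>n. real n ^ i) *\<^sub>R a i)" for j
    by (simp add: q forward_difference_sum forward_difference_scaleR)
  have "q t = (\<Sum>i\<le>k. (\<Sum>j\<le>k. (t gchoose j) * forward_difference j (\<lambda>n. real n ^ i)) *\<^sub>R a i)"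
    unfolding q by (intro sum.cong refl) (simp add: newton_forward_difference_power)
  also have "\<dots> = (\<Sum>j\<le>k. (t gchoose j) *\<^sub>R ?D j)"
    by (simp add: D scaleR_sum_left scaleR_sum_right) (rule sum.swap)
  also have "\<dots> = q 0 + (\<Sum>j<k. (t gchoose Suc j) *\<^sub>R ?D (Suc j))"
    unfolding lessThan_Suc_atMost[symmetric] by (subst sum.lessThan_Suc_shift) simp
  \<comment> \<open>Only the term of index \<open>0\<close> lacks a factor of size \<open>t\<close>,
    and subtracting \<open>q 0\<close> removes it.\<close>
  finally have "q t - q 0 = (\<Sum>j<k. (t gchoose Suc j) *\<^sub>R ?D (Suc j))" by simp
  also have "norm \<dots> \<le> (\<Sum>j<k. t * (2 ^ Suc j * M))"
  proof (intro sum_norm_le)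
    fix j assume "j \<in> {..<k}"
    then have "norm (?D (Suc j)) \<le> 2 ^ Suc j * M"
      by (intro norm_forward_difference_le M) auto
    then show "norm ((t gchoose Suc j) *\<^sub>R ?D (Suc j)) \<le> t * (2 ^ Suc j * M)"
      using abs_gbinomial_le[OF t, of j] t by (simp only: norm_scaleR) (intro mult_mono, auto)
  qed
  also have "\<dots> = t * M * (2 * (2 ^ k - 1))"
    using sum_gp_strict[of "2::real" k] by (simp add: sum_distrib_left[symmetric] mult_ac)
  also have "\<dots> \<le> t * M * (2 * 2 ^ k)"
    using t order_trans[OF norm_ge_zero M[of 0]] by (intro mult_left_mono) auto
  finally show ?thesis by (simp add: mult_ac)
qed

text \<open>Multilinear expansion of \<open>u\<close> at \<open>x + t *\<^sub>R y\<close>, one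
  argument at a time. The coefficients need no closed form; only the degree bound \<open>k\<close>
  is used later.\<close>

lemma homogeneous_polynomial_on_line:
  fixes p :: "'a::real_normed_vector \<Rightarrow> 'b::real_normed_vector"
  assumes "continuous_homogeneous_polynomial k p"
  obtains a where "\<And>t. p (x + t *\<^sub>R y) = (\<Sum>i\<le>k. t ^ i *\<^sub>R a i)"
proof -
  obtain u where u: "continuous_multilinear k u" and p: "\<And>h. p h = u (\<lambda>_. h)"
    using assms by (auto simp: continuous_homogeneous_polynomial_def)
  have ext: "u v = u w" if "\<And>i. i < k \<Longrightarrow> v i = w i" for v w
    using u that by (auto simp: continuous_multilinear_def)
  have lin: "linear (\<lambda>s. u (z(i := s)))" if "i < k" for z i
    using u that by (auto simp: continuous_multilinear_def)
  \<comment> \<open>The first \<open>m\<close> arguments run along the line and the others are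
    frozen at \<open>z\<close>. Since \<open>z\<close> is arbitrary, the hypothesis applies with
    argument \<open>m\<close> frozen at \<open>x\<close> and at \<open>y\<close>, and linearity in
    that argument combines the two expansions.\<close>
  have "\<exists>a. \<forall>t. u (\<lambda>i. if i < m then x + t *\<^sub>R y else z i) = (\<Sum>i\<le>m. t ^ i *\<^sub>R a i)"
    if "m \<le> k" for m z
    using that
  proof (induction m arbitrary: z)
    case 0
    show ?case by (intro exI[of _ "\<lambda>_. u z"]) simp
  next
    case (Suc m)
    obtain a b where
      a: "\<And>t. u (\<lambda>i. if i < m then x + t *\<^sub>R y else (z(m := x)) i) = (\<Sum>i\<le>m. t ^ i *\<^sub>R a i)" and
      b: "\<And>t. u (\<lambda>i. if i < m then x + t *\<^sub>R y else (z(m := y)) i) = (\<Sum>i\<le>m. t ^ i *\<^sub>R b i)"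
      using Suc.IH[of "z(m := x)"] Suc.IH[of "z(m := y)"] Suc.prems by auto
    let ?c = "\<lambda>i. (if i \<le> m then a i else 0) + (case i of 0 \<Rightarrow> 0 | Suc i \<Rightarrow> b i)"
    have "u (\<lambda>i. if i < Suc m then x + t *\<^sub>R y else z i) = (\<Sum>i\<le>Suc m. t ^ i *\<^sub>R ?c i)" for t
    proof -
      let ?v = "\<lambda>i. if i < m then x + t *\<^sub>R y else z i"
      have "u (?v(m := x + t *\<^sub>R y)) = u (?v(m := x)) + t *\<^sub>R u (?v(m := y))"
        using linear_add[OF lin[of m ?v], of x "t *\<^sub>R y"] linear_scale[OF lin[of m ?v], of t y] Suc.prems
        by simp
      moreover have "?v(m := x + t *\<^sub>R y) = (\<lambda>i. if i < Suc m then x + t *\<^sub>R y else z i)"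
        by auto
      moreover have "?v(m := s) = (\<lambda>i. if i < m then x + t *\<^sub>R y else (z(m := s)) i)" for s
        by auto
      ultimately have "u (\<lambda>i. if i < Suc m then x + t *\<^sub>R y else z i)
          = (\<Sum>i\<le>m. t ^ i *\<^sub>R a i) + t *\<^sub>R (\<Sum>i\<le>m. t ^ i *\<^sub>R b i)"
        using a b by simp
      also have "(\<Sum>i\<le>m. t ^ i *\<^sub>R a i) = (\<Sum>i\<le>Suc m. t ^ i *\<^sub>R (if i \<le> m then a i else 0))"
        by simp
      also have "t *\<^sub>R (\<Sum>i\<le>m. t ^ i *\<^sub>R b i)
          = (\<Sum>i\<le>Suc m. t ^ i *\<^sub>R (case i of 0 \<Rightarrow> 0 | Suc i \<Rightarrow> b i))"
        by (subst sum.atMost_Suc_shift) (simp add: scaleR_sum_right)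
      finally show ?thesis
        by (simp only: scaleR_add_right sum.distrib)
    qed
    then show ?case by (intro exI[of _ ?c]) blast
  qed
  from this[of k "\<lambda>_. 0"] obtain a
    where a: "\<And>t. u (\<lambda>i. if i < k then x + t *\<^sub>R y else 0) = (\<Sum>i\<le>k. t ^ i *\<^sub>R a i)"
    by auto
  have "u (\<lambda>_. h) = u (\<lambda>i. if i < k then h else 0)" for h
    by (rule ext) simp
  then show thesis by (intro that[of a]) (simp add: p a)
qed

text \<open>The segment from \<open>x\<close> to \<open>y\<close> is prolonged to \<open>k\<close>
  steps of length \<open>s / k\<close>; all nodes stay in the ball of radius \<open>2 * s\<close>,
  where \<open>p\<close> is bounded by \<open>c * (2 * s) ^ k\<close>, and interpolation bounds the
  increment. If \<open>y\<close> lies beyond the first step, \<open>k * d / s\<close> exceeds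
  \<open>1\<close> and the bound of both values is enough.\<close>

lemma homogeneous_polynomial_lipschitz:
  fixes p :: "'a::real_normed_vector \<Rightarrow> 'b::real_normed_vector"
  assumes p: "continuous_homogeneous_polynomial k p"
    and c: "\<And>h. norm (p h) \<le> c * norm h ^ k"
    and s: "0 < s" and x: "norm x \<le> s" "norm y \<le> s"
  shows "norm (p y - p x) \<le> norm (y - x) * (2 / s * (c * (8 * s) ^ k))"
proof (cases "y = x")
  case False
  define d where "d = norm (y - x)"
  have d: "d > 0" using False by (simp add: d_def)
  have c0: "c \<ge> 0"
    using order_trans[OF norm_ge_zero c[of "y - x"]] zero_less_power[OF d, of k]
    by (simp add: d_def[symmetric] zero_le_mult_iff)
  have "norm (p y - p x) \<le> (real k * d / s) * 2 ^ Suc k * (c * (2 * s) ^ k)"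
  proof (cases "real k * d \<le> s")
    case True
    show ?thesis
    \<comment> \<open>The step length \<open>s / k\<close> makes no sense in degree
      \<open>0\<close>, where \<open>p\<close> is constant.\<close>
    proof (cases "k = 0")
      case True
      obtain a where "\<And>t. p (x + t *\<^sub>R (y - x)) = (\<Sum>i\<le>k. t ^ i *\<^sub>R a i)"
        using homogeneous_polynomial_on_line[OF p] by metis
      from this[of 0] this[of 1] show ?thesis using True by simp
    next
      case False
      define v where "v = (s / (real k * d)) *\<^sub>R (y - x)"
      define t where "t = real k * d / s"
      obtain a where a: "\<And>t. p (x + t *\<^sub>R v) = (\<Sum>i\<le>k. t ^ i *\<^sub>R a i)"
        using homogeneous_polynomial_on_line[OF p] by metis
      have v: "real k * norm v = s"
        using False d s by (simp add: v_def d_def[symmetric])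
      have "norm (p (x + t *\<^sub>R v) - p (x + 0 *\<^sub>R v)) \<le> t * 2 ^ Suc k * (c * (2 * s) ^ k)"
      proof (rule norm_vector_polynomial_increment_le[OF a])
        fix n assume n: "n \<le> k"
        have "norm (x + real n *\<^sub>R v) \<le> norm x + real n * norm v"
          using norm_triangle_ineq[of x "real n *\<^sub>R v"] by simp
        also have "real n * norm v \<le> real k * norm v"
          using n by (intro mult_right_mono) auto
        finally have "norm (x + real n *\<^sub>R v) \<le> 2 * s" using x v by simp
        then show "norm (p (x + real n *\<^sub>R v)) \<le> c * (2 * s) ^ k"
          using c0 by (intro order_trans[OF c] mult_left_mono power_mono) auto
      qed (use True d s in \<open>auto simp: t_def\<close>)
      moreover have "x + t *\<^sub>R v = y"
        using False d s by (simp add: v_def t_def)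
      ultimately show ?thesis by (simp add: t_def)
    qed
  next
    case False
    have "norm (p z) \<le> c * (2 * s) ^ k" if "norm z \<le> s" for z
      using c0 that s by (intro order_trans[OF c] mult_left_mono power_mono) auto
    from this[OF x(1)] this[OF x(2)]
    have "norm (p y - p x) \<le> 1 * 2 * (c * (2 * s) ^ k)"
      using norm_triangle_ineq4[of "p y" "p x"] by simp
    also have "\<dots> \<le> (real k * d / s) * 2 ^ Suc k * (c * (2 * s) ^ k)"
      using False s c0 d by (intro mult_right_mono mult_mono) (auto simp: divide_simps)
    finally show ?thesis .
  qed
  also have "\<dots> = (d / s * 2 * (c * (2 ^ k * (2 * s) ^ k))) * real k"
    by simp
  \<comment> \<open>The factor \<open>k\<close> from the step length is absorbed into
    \<open>2 ^ k\<close> to keep the bound geometric. With \<open>2 ^ k\<close> from the differences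
    and \<open>(2 * s) ^ k\<close> from the nodes this gives \<open>(8 * s) ^ k\<close>.\<close>
  also have "\<dots> \<le> (d / s * 2 * (c * (2 ^ k * (2 * s) ^ k))) * 2 ^ k"
    using d s c0 of_nat_less_two_power[of k, where 'a=real] by (intro mult_left_mono) auto
  also have "\<dots> = d * (2 / s * (c * (2 ^ k * 2 ^ k * (2 * s) ^ k)))"
    by simp
  also have "2 ^ k * 2 ^ k * (2 * s) ^ k = (8 * s) ^ k"
    by (simp only: power_mult_distrib[symmetric]) simp
  finally show ?thesis by (simp add: d_def)
qed simp

text \<open>The polynomial estimate is summed over the degrees; normal convergence at radius
  \<open>r\<close> makes the Lipschitz constants of the terms summable.\<close>

lemma real_analytic_on_locally_lipschitz:
  fixes f :: "'a::real_normed_vector \<Rightarrow> 'b::banach"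
  assumes "real_analytic_on f U" "a \<in> U"
  obtains s C where "0 < s" "0 \<le> C" "ball a s \<subseteq> U"
    and "\<And>x y. x \<in> ball a s \<Longrightarrow> y \<in> ball a s \<Longrightarrow> norm (f y - f x) \<le> C * norm (y - x)"
proof -
  obtain p :: "nat \<Rightarrow> 'a \<Rightarrow> 'b" and c r where r: "0 < r"
    and p: "\<And>k. continuous_homogeneous_polynomial k (p k)"
    and c: "\<And>k h. norm (p k h) \<le> c k * norm h ^ k"
    and sm: "summable (\<lambda>k. c k * r ^ k)"
    and f: "\<And>h. norm h < r \<Longrightarrow> a + h \<in> U \<and> (\<lambda>k. p k h) sums f (a + h)"
    using bspec[OF assms(1)[unfolded real_analytic_on_def] assms(2)] by blast
  \<comment> \<open>With \<open>8 * s = r\<close> the bound for degree \<open>k\<close> is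
    \<open>2 / s\<close> times \<open>c k * r ^ k\<close>, a term of the given convergent
    series.\<close>
  define s where "s = r / 8"
  define C where "C = 2 / s * (\<Sum>k. c k * r ^ k)"
  have s: "0 < s" "8 * s = r" "s < r" using r by (auto simp: s_def)
  have in_ball: "norm (x - a) < r" if "x \<in> ball a s" for x
    using that s by (simp add: dist_norm norm_minus_commute)
  have lip: "norm (f y - f x) \<le> \<bar>C\<bar> * norm (y - x)" if xy: "x \<in> ball a s" "y \<in> ball a s" for x y
  proof -
    have "(\<lambda>k. p k (y - a) - p k (x - a)) sums (f y - f x)"
      using f[OF in_ball[OF xy(1)]] f[OF in_ball[OF xy(2)]] by (intro sums_diff) auto
    moreover have "(\<lambda>k. norm (y - x) * (2 / s * (c k * r ^ k))) sums (norm (y - x) * C)"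
      unfolding C_def by (intro sums_mult summable_sums sm)
    moreover have "norm (p k (y - a) - p k (x - a)) \<le> norm (y - x) * (2 / s * (c k * r ^ k))" for k
      using homogeneous_polynomial_lipschitz[OF p c s(1), of "x - a" "y - a" k] xy s(2)
      by (simp add: dist_norm norm_minus_commute)
    ultimately have "norm (f y - f x) \<le> norm (y - x) * C"
      by (rule norm_sums_le)
    also have "\<dots> \<le> \<bar>C\<bar> * norm (y - x)"
      by (simp add: mult.commute mult_right_mono)
    finally show ?thesis .
  qed
  moreover have "ball a s \<subseteq> U"
  proof
    fix x assume "x \<in> ball a s"
    from f[OF in_ball[OF this]] show "x \<in> U" by simp
  qed
  ultimately show thesis by (intro that[of s "\<bar>C\<bar>"]) (use s in auto)
qed

section \<open>Gauges on Banach--Lie groups\<close>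

lemma is_chartD:
  assumes "is_chart T (U, \<phi>)"
  shows "openin T U" "inj_on \<phi> U"
    and "\<And>S. open S \<Longrightarrow> openin T {x \<in> U. \<phi> x \<in> S}"
    and "\<And>S. openin T S \<Longrightarrow> S \<subseteq> U \<Longrightarrow> open (\<phi> ` S)"
proof -
  have U: "openin T U" and im: "open (\<phi> ` U)"
    and h: "homeomorphic_map (subtopology T U) (top_of_set (\<phi> ` U)) \<phi>"
    using assms by (auto simp: is_chart_def)
  have tU: "topspace (subtopology T U) = U"
    using openin_subset[OF U] by auto
  show "openin T U" by (rule U)
  show "inj_on \<phi> U"
    using homeomorphic_imp_injective_map[OF h] by (simp only: tU)
  show "openin T {x \<in> U. \<phi> x \<in> S}" if "open S" for S
  proof -
    have "openin (top_of_set (\<phi> ` U)) (\<phi> ` U \<inter> S)"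
      using that by (simp add: openin_open_Int)
    from openin_continuous_map_preimage[OF homeomorphic_imp_continuous_map[OF h] this]
    have "openin (subtopology T U) {x \<in> U. \<phi> x \<in> \<phi> ` U \<inter> S}"
      by (simp only: tU)
    moreover have "{x \<in> U. \<phi> x \<in> \<phi> ` U \<inter> S} = {x \<in> U. \<phi> x \<in> S}" by auto
    ultimately show ?thesis
      using U by (simp add: openin_open_subtopology)
  qed
  show "open (\<phi> ` S)" if "openin T S" "S \<subseteq> U" for S
  proof -
    have "openin (subtopology T U) S"
      using that U by (simp add: openin_open_subtopology)
    then have "openin (top_of_set (\<phi> ` U)) (\<phi> ` S)"
      using homeomorphic_imp_open_map[OF h] by (simp add: open_map_def)
    then show ?thesis using im by (simp add: openin_open_eq)
  qed
qed

lemma banach_lie_group_imp_hausdorff_group: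
  "banach_lie_group G T A \<Longrightarrow> hausdorff_group G T"
  by (simp add: banach_lie_group_def hausdorff_group_def analytic_manifold_def analytic_map_def)

lemma banach_lie_group_chart:
  assumes "banach_lie_group G T A" "(U, \<phi>) \<in> A"
  shows "is_chart T (U, \<phi>)"
  using assms by (auto simp: banach_lie_group_def analytic_manifold_def)

lemma banach_lie_group_chart_at:
  assumes "banach_lie_group G T A" "x \<in> carrier G"
  obtains U \<phi> where "(U, \<phi>) \<in> A" "x \<in> U"
proof -
  have "(\<Union>(U, \<phi>)\<in>A. U) = carrier G"
    using assms(1) by (simp add: banach_lie_group_def analytic_manifold_def)
  with assms(2) show thesis using that by blast
qed

lemma inv_into_map_prod:
  assumes "inj_on f A" "inj_on g B" "a \<in> A" "b \<in> B"
  shows "inv_into (A \<times> B) (map_prod f g) (f a, g b) = (a, b)"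
  using inv_into_f_f[OF map_prod_inj_on[OF assms(1,2)], of "(a, b)"] assms(3,4) by simp

text \<open>The chart expression of the product is analytic on the part of the product chart that
  multiplication sends into \<open>W\<close>. The ball found there yields both the inclusion in
  \<open>W\<close> and the estimate. The three charts are independent, so the lemma also serves for
  products far from the unit.\<close>

lemma banach_lie_group_mult_locally_lipschitz:
  fixes G :: "('g, 'x) monoid_scheme" and A :: "('g, 'e::banach) chart set"
  assumes G: "banach_lie_group G T A"
    and A: "(U, \<phi>) \<in> A" "(V, \<psi>) \<in> A" "(W, \<eta>) \<in> A"
    and ab: "a \<in> U" "b \<in> V" "a \<otimes>\<^bsub>G\<^esub> b \<in> W"
  obtains U' V' C where "openin T U'" "openin T V'" "a \<in> U'" "U' \<subseteq> U" "b \<in> V'" "V' \<subseteq> V" "0 \<le> C"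
    and "\<And>x y. x \<in> U' \<Longrightarrow> y \<in> V' \<Longrightarrow> x \<otimes>\<^bsub>G\<^esub> y \<in> W"
    and "\<And>x y x' y'. x \<in> U' \<Longrightarrow> y \<in> V' \<Longrightarrow> x' \<in> U' \<Longrightarrow> y' \<in> V' \<Longrightarrow>
           norm (\<eta> (x \<otimes>\<^bsub>G\<^esub> y) - \<eta> (x' \<otimes>\<^bsub>G\<^esub> y')) \<le> C * (norm (\<phi> x - \<phi> x') + norm (\<psi> y - \<psi> y'))"
proof -
  let ?m = "\<lambda>(x, y). x \<otimes>\<^bsub>G\<^esub> y"
  let ?D = "U \<times> V \<inter> ?m -` W" and ?f = "\<eta> \<circ> ?m \<circ> inv_into (U \<times> V) (map_prod \<phi> \<psi>)"
  note \<phi> = is_chartD[OF banach_lie_group_chart[OF G A(1)]]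
  note \<psi> = is_chartD[OF banach_lie_group_chart[OF G A(2)]]
  have "(U \<times> V, map_prod \<phi> \<psi>) \<in> product_atlas A A"
    using A by (auto simp: product_atlas_def)
  then have "real_analytic_on ?f (map_prod \<phi> \<psi> ` ?D)"
    using G A(3) by (fastforce simp: banach_lie_group_def analytic_map_def)
  moreover have "(\<phi> a, \<psi> b) \<in> map_prod \<phi> \<psi> ` ?D"
    using ab by (intro image_eqI[of _ _ "(a, b)"]) auto
  ultimately obtain s C where s: "0 < s" and C: "0 \<le> C"
    and sub: "ball (\<phi> a, \<psi> b) s \<subseteq> map_prod \<phi> \<psi> ` ?D"
    and lip: "\<And>p q. p \<in> ball (\<phi> a, \<psi> b) s \<Longrightarrow> q \<in> ball (\<phi> a, \<psi> b) s \<Longrightarrow>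
                norm (?f q - ?f p) \<le> C * norm (q - p)"
    by (rule real_analytic_on_locally_lipschitz) (rule that)
  \<comment> \<open>The distance in the product is at most the sum of the two distances, so half the
    radius in each factor is enough.\<close>
  define U' where "U' = {x \<in> U. \<phi> x \<in> ball (\<phi> a) (s / 2)}"
  define V' where "V' = {y \<in> V. \<psi> y \<in> ball (\<psi> b) (s / 2)}"
  have in_ball: "(\<phi> x, \<psi> y) \<in> ball (\<phi> a, \<psi> b) s" if "x \<in> U'" "y \<in> V'" for x y
  proof -
    have "dist (\<phi> a, \<psi> b) (\<phi> x, \<psi> y) \<le> dist (\<phi> a) (\<phi> x) + dist (\<psi> b) (\<psi> y)"
      by (simp add: dist_Pair_Pair sqrt_sum_squares_le_sum)
    also have "\<dots> < s" using that by (simp add: U'_def V'_def)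
    finally show ?thesis by simp
  qed
  have f: "?f (\<phi> x, \<psi> y) = \<eta> (x \<otimes>\<^bsub>G\<^esub> y)" if "x \<in> U'" "y \<in> V'" for x y
    using inv_into_map_prod[OF \<phi>(2) \<psi>(2), of x y] that by (simp add: U'_def V'_def)
  show thesis
  proof (rule that[of U' V' C])
    show "openin T U'" "openin T V'"
      unfolding U'_def V'_def by (intro \<phi>(3) \<psi>(3) open_ball)+
    show "x \<otimes>\<^bsub>G\<^esub> y \<in> W" if xy: "x \<in> U'" "y \<in> V'" for x y
    proof -
      \<comment> \<open>The ball is only known to lie in the image of \<open>?D\<close>; injectivity
        of the charts identifies the preimage with the given pair.\<close>
      obtain x' y' where "(x', y') \<in> ?D" "\<phi> x = \<phi> x'" "\<psi> y = \<psi> y'"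
        using subsetD[OF sub in_ball[OF xy]] by auto
      moreover from this have "x = x'" "y = y'"
        using xy inj_onD[OF \<phi>(2), of x x'] inj_onD[OF \<psi>(2), of y y'] by (auto simp: U'_def V'_def)
      ultimately show ?thesis by simp
    qed
    fix x y x' y' assume xy: "x \<in> U'" "y \<in> V'" and xy': "x' \<in> U'" "y' \<in> V'"
    have "norm (\<eta> (x \<otimes>\<^bsub>G\<^esub> y) - \<eta> (x' \<otimes>\<^bsub>G\<^esub> y')) \<le> C * norm ((\<phi> x, \<psi> y) - (\<phi> x', \<psi> y'))"
      using lip[OF in_ball[OF xy'] in_ball[OF xy]] f[OF xy] f[OF xy'] by simp
    also have "\<dots> \<le> C * (norm (\<phi> x - \<phi> x') + norm (\<psi> y - \<psi> y'))"
      using C by (intro mult_left_mono) (simp_all add: norm_Pair sqrt_sum_squares_le_sum)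
    finally show "norm (\<eta> (x \<otimes>\<^bsub>G\<^esub> y) - \<eta> (x' \<otimes>\<^bsub>G\<^esub> y')) \<le> \<dots>" .
  qed (use s C ab in \<open>auto simp: U'_def V'_def\<close>)
qed

section \<open>Continuity of the group operations in terms of neighbourhoods\<close>

lemma openin_prod_topologyE:
  assumes "openin (prod_topology X Y) S" "(x, y) \<in> S"
  obtains U V where "openin X U" "openin Y V" "x \<in> U" "y \<in> V" "U \<times> V \<subseteq> S"
proof -
  have "\<exists>U V. openin X U \<and> openin Y V \<and> x \<in> U \<and> y \<in> V \<and> U \<times> V \<subseteq> S"
    using assms by (simp only: openin_prod_topology_alt)
  then show thesis by (elim exE conjE) (rule that)
qed

lemma hausdorff_group_mult_nhds:
  assumes G: "hausdorff_group G T" and W: "openin T W" and ab: "a \<in> carrier G" "b \<in> carrier G" "a \<otimes>\<^bsub>G\<^esub> b \<in> W"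
  obtains U V where "openin T U" "openin T V" "a \<in> U" "b \<in> V"
    "\<And>x y. x \<in> U \<Longrightarrow> y \<in> V \<Longrightarrow> x \<otimes>\<^bsub>G\<^esub> y \<in> W"
proof -
  have t: "topspace T = carrier G"
    and m: "continuous_map (prod_topology T T) T (\<lambda>(x, y). x \<otimes>\<^bsub>G\<^esub> y)"
    using G by (auto simp: hausdorff_group_def)
  from openin_continuous_map_preimage[OF m W]
  have "openin (prod_topology T T) {p \<in> carrier G \<times> carrier G. (\<lambda>(x, y). x \<otimes>\<^bsub>G\<^esub> y) p \<in> W}"
    by (simp add: t)
  then obtain U V where "openin T U" "openin T V" "a \<in> U" "b \<in> V"
    and "U \<times> V \<subseteq> {p \<in> carrier G \<times> carrier G. (\<lambda>(x, y). x \<otimes>\<^bsub>G\<^esub> y) p \<in> W}"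
    by (rule openin_prod_topologyE[of _ _ _ a b]) (use ab in auto)
  then show thesis by (intro that[of U V]) auto
qed

lemma hausdorff_group_inv_nhds:
  assumes G: "hausdorff_group G T" and W: "openin T W" and a: "a \<in> carrier G" "inv\<^bsub>G\<^esub> a \<in> W"
  obtains U where "openin T U" "a \<in> U" "\<And>x. x \<in> U \<Longrightarrow> inv\<^bsub>G\<^esub> x \<in> W"
proof -
  have t: "topspace T = carrier G" and m: "continuous_map T T (\<lambda>x. inv\<^bsub>G\<^esub> x)"
    using G by (auto simp: hausdorff_group_def)
  show thesis
    using openin_continuous_map_preimage[OF m W] a
    by (intro that[of "{x \<in> topspace T. inv\<^bsub>G\<^esub> x \<in> W}"]) (auto simp: t)
qed

text \<open>
  A substitute for the right invariant Finsler length of a Banach--Lie group: \<open>w\<close> is not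
  subadditive, but the last condition says that the subadditive function it generates is still
  positive away from the unit.
\<close>
definition conjugation_gauge :: "('g, 'x) monoid_scheme \<Rightarrow> 'g topology \<Rightarrow> ('g \<Rightarrow> real) \<Rightarrow> bool" where
  "conjugation_gauge G T w \<longleftrightarrow>
     (\<forall>x\<in>carrier G. 0 \<le> w x \<and> w x \<le> 1 \<and> w (inv\<^bsub>G\<^esub> x) = w x) \<and>
     (\<forall>e>0. \<exists>V. openin T V \<and> \<one>\<^bsub>G\<^esub> \<in> V \<and> (\<forall>x\<in>V. w x < e)) \<and>
     (\<forall>a\<in>carrier G. \<exists>V L. openin T V \<and> a \<in> V \<and> 1 \<le> L \<and>
        (\<forall>g\<in>V. \<forall>x\<in>carrier G. w (g \<otimes>\<^bsub>G\<^esub> x \<otimes>\<^bsub>G\<^esub> inv\<^bsub>G\<^esub> g) \<le> L * w x)) \<and>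
     (\<forall>V. openin T V \<longrightarrow> \<one>\<^bsub>G\<^esub> \<in> V \<longrightarrow>
        (\<exists>d>0. \<forall>xs. set xs \<subseteq> carrier G \<longrightarrow> sum_list (map w xs) < d \<longrightarrow> foldr (mult G) xs \<one>\<^bsub>G\<^esub> \<in> V))"

text \<open>The gauge is the chart distance to the unit, truncated at \<open>1\<close> and
  symmetrised under inversion. Conjugation near \<open>a\<close> is Lipschitz at the unit as a
  composite of two multiplications; truncation takes care of elements far from the unit.\<close>

lemma banach_lie_group_conjugation_gauge:
  fixes G :: "('g, 'x) monoid_scheme" and A :: "('g, 'e::banach) chart set"
  assumes G: "banach_lie_group G T A"
  obtains w where "conjugation_gauge G T w"
proof -
  have HG: "hausdorff_group G T" by (rule banach_lie_group_imp_hausdorff_group[OF G])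
  then interpret group G by (simp add: hausdorff_group_def)
  have topT: "topspace T = carrier G" using HG by (simp add: hausdorff_group_def)
  have carr: "x \<in> carrier G" if "openin T V" "x \<in> V" for x V
    using openin_subset[OF that(1)] that(2) topT by auto
  obtain E \<theta> where E: "(E, \<theta>) \<in> A" "\<one>\<^bsub>G\<^esub> \<in> E"
    using banach_lie_group_chart_at[OF G one_closed] .
  note \<theta> = is_chartD[OF banach_lie_group_chart[OF G E(1)]]
  define n where "n x = norm (\<theta> x - \<theta> \<one>\<^bsub>G\<^esub>)" for x
  \<comment> \<open>The default \<open>1\<close> is the largest possible value, so
    \<open>v x < 1\<close> alone places \<open>x\<close> in the chart and gives
    \<open>v x = n x\<close>.\<close>
  define v where "v x = (if x \<in> E then min 1 (n x) else 1)" for x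
  define w where "w x = max (v x) (v (inv\<^bsub>G\<^esub> x))" for x
  have n0: "0 \<le> n x" for x by (simp add: n_def)
  have v01: "0 \<le> v x" "v x \<le> 1" for x by (auto simp: v_def n_def)
  have vE: "x \<in> E" "v x = n x" if "v x < 1" for x
    using that by (auto simp: v_def split: if_splits)
  have v_base: "\<exists>d. 0 < d \<and> d \<le> 1 \<and> (\<forall>x. v x < d \<longrightarrow> x \<in> V)" if V: "openin T V" "\<one>\<^bsub>G\<^esub> \<in> V" for V
  proof -
    have "open (\<theta> ` (E \<inter> V))"
      using V \<theta>(1) by (intro \<theta>(4)) auto
    then obtain d where d: "0 < d" "ball (\<theta> \<one>\<^bsub>G\<^esub>) d \<subseteq> \<theta> ` (E \<inter> V)"
      using E V by (force simp: open_contains_ball)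
    show ?thesis
    proof (intro exI[of _ "min d 1"] conjI allI impI)
      fix x assume x: "v x < min d 1"
      then have "x \<in> E" "\<theta> x \<in> ball (\<theta> \<one>\<^bsub>G\<^esub>) d"
        using vE[of x] by (auto simp: n_def dist_norm norm_minus_commute)
      then obtain y where "y \<in> E \<inter> V" "\<theta> x = \<theta> y" using d by blast
      then show "x \<in> V" using inj_onD[OF \<theta>(2), of x y] \<open>x \<in> E\<close> by auto
    qed (use d in auto)
  qed
  have v_cont: "\<exists>V. openin T V \<and> \<one>\<^bsub>G\<^esub> \<in> V \<and> (\<forall>x\<in>V. v x < e)" if e: "0 < e" for e
    using \<theta>(3)[of "ball (\<theta> \<one>\<^bsub>G\<^esub>) e"] E(2) e
    by (intro exI[of _ "{x \<in> E. \<theta> x \<in> ball (\<theta> \<one>\<^bsub>G\<^esub>) e}"])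
       (auto simp: v_def n_def dist_norm norm_minus_commute)
  have w_cont: "\<exists>V. openin T V \<and> \<one>\<^bsub>G\<^esub> \<in> V \<and> (\<forall>x\<in>V. w x < e)" if e: "0 < e" for e
  proof -
    obtain V where V: "openin T V" "\<one>\<^bsub>G\<^esub> \<in> V" "\<forall>x\<in>V. v x < e" using v_cont[OF e] by blast
    obtain V' where "openin T V'" "\<one>\<^bsub>G\<^esub> \<in> V'" "\<And>x. x \<in> V' \<Longrightarrow> inv\<^bsub>G\<^esub> x \<in> V"
      by (rule hausdorff_group_inv_nhds[OF HG V(1) one_closed]) (use V in auto)
    with V show ?thesis by (intro exI[of _ "V \<inter> V'"]) (auto simp: w_def)
  qed
  have v_conj: "\<exists>V L. openin T V \<and> a \<in> V \<and> 1 \<le> L \<and>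
      (\<forall>g\<in>V. \<forall>x\<in>carrier G. v (g \<otimes>\<^bsub>G\<^esub> x \<otimes>\<^bsub>G\<^esub> inv\<^bsub>G\<^esub> g) \<le> L * v x)" if a: "a \<in> carrier G" for a
  proof -
    obtain U \<phi> where U: "(U, \<phi>) \<in> A" "a \<in> U" using banach_lie_group_chart_at[OF G a] .
    obtain W \<psi> where W: "(W, \<psi>) \<in> A" "inv\<^bsub>G\<^esub> a \<in> W"
      using banach_lie_group_chart_at[OF G inv_closed[OF a]] .
    \<comment> \<open>Conjugation is split into \<open>x \<mapsto> g \<otimes> x\<close>, from the
      chart at the unit to a chart at \<open>a\<close>, and right multiplication by the inverse of
      \<open>g\<close>, back to the chart at the unit.\<close>
    obtain U1 V1 C1 where 1: "openin T U1" "openin T V1" "a \<in> U1" "\<one>\<^bsub>G\<^esub> \<in> V1" "0 \<le> C1"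
      and lip1: "\<And>x y x' y'. x \<in> U1 \<Longrightarrow> y \<in> V1 \<Longrightarrow> x' \<in> U1 \<Longrightarrow> y' \<in> V1 \<Longrightarrow>
        norm (\<phi> (x \<otimes>\<^bsub>G\<^esub> y) - \<phi> (x' \<otimes>\<^bsub>G\<^esub> y')) \<le> C1 * (norm (\<phi> x - \<phi> x') + norm (\<theta> y - \<theta> y'))"
      by (rule banach_lie_group_mult_locally_lipschitz[OF G U(1) E(1) U(1) U(2) E(2)])
         (use a U in simp_all)
    obtain U2 V2 C2 where 2: "openin T U2" "openin T V2" "a \<in> U2" "inv\<^bsub>G\<^esub> a \<in> V2" "0 \<le> C2"
      and in_E: "\<And>x y. x \<in> U2 \<Longrightarrow> y \<in> V2 \<Longrightarrow> x \<otimes>\<^bsub>G\<^esub> y \<in> E"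
      and lip2: "\<And>x y x' y'. x \<in> U2 \<Longrightarrow> y \<in> V2 \<Longrightarrow> x' \<in> U2 \<Longrightarrow> y' \<in> V2 \<Longrightarrow>
        norm (\<theta> (x \<otimes>\<^bsub>G\<^esub> y) - \<theta> (x' \<otimes>\<^bsub>G\<^esub> y')) \<le> C2 * (norm (\<phi> x - \<phi> x') + norm (\<psi> y - \<psi> y'))"
      by (rule banach_lie_group_mult_locally_lipschitz[OF G U(1) W(1) E(1) U(2) W(2)])
         (use a E in simp_all)
    obtain U3 V3 where 3: "openin T U3" "openin T V3" "a \<in> U3" "\<one>\<^bsub>G\<^esub> \<in> V3"
      "\<And>x y. x \<in> U3 \<Longrightarrow> y \<in> V3 \<Longrightarrow> x \<otimes>\<^bsub>G\<^esub> y \<in> U2"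
      by (rule hausdorff_group_mult_nhds[OF HG 2(1) a one_closed]) (use 2 a in auto)
    obtain U4 where 4: "openin T U4" "a \<in> U4" "\<And>x. x \<in> U4 \<Longrightarrow> inv\<^bsub>G\<^esub> x \<in> V2"
      by (rule hausdorff_group_inv_nhds[OF HG 2(2) a]) (use 2 in auto)
    obtain d where d: "0 < d" "d \<le> 1" "\<And>x. v x < d \<Longrightarrow> x \<in> V1 \<inter> V3"
      using v_base[of "V1 \<inter> V3"] 1 3 by blast
    \<comment> \<open>\<open>C2 * C1\<close> serves for \<open>v x < d\<close>, where both local
      estimates apply. For \<open>d \<le> v x\<close> the bound \<open>v \<le> 1\<close> on the left
      is enough, whence \<open>1 / d\<close>.\<close>
    define L where "L = max 1 (max (C2 * C1) (1 / d))"
    have "v (g \<otimes>\<^bsub>G\<^esub> x \<otimes>\<^bsub>G\<^esub> inv\<^bsub>G\<^esub> g) \<le> L * v x" if g: "g \<in> U1 \<inter> U2 \<inter> U3 \<inter> U4" for g x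
    proof (cases "v x < d")
      case True
      have gc: "g \<in> carrier G" using carr[OF 1(1)] g by auto
      have gx: "g \<otimes>\<^bsub>G\<^esub> x \<in> U2" "inv\<^bsub>G\<^esub> g \<in> V2" using 3 4 g d(3)[OF True] by auto
      have "v (g \<otimes>\<^bsub>G\<^esub> x \<otimes>\<^bsub>G\<^esub> inv\<^bsub>G\<^esub> g) \<le> n (g \<otimes>\<^bsub>G\<^esub> x \<otimes>\<^bsub>G\<^esub> inv\<^bsub>G\<^esub> g)"
        using in_E[OF gx] by (simp add: v_def)
      \<comment> \<open>The comparison is with \<open>g\<close> times its inverse, which is the
        unit. The right factors coincide, so only the left ones contribute.\<close>
      also have "\<dots> \<le> C2 * norm (\<phi> (g \<otimes>\<^bsub>G\<^esub> x) - \<phi> g)"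
        using lip2[OF gx, of g "inv\<^bsub>G\<^esub> g"] gx g gc by (simp add: n_def)
      also have "\<dots> \<le> C2 * (C1 * n x)"
        using lip1[of g x g "\<one>\<^bsub>G\<^esub>"] g gc 1 2 d(3)[OF True]
        by (intro mult_left_mono) (auto simp: n_def)
      also have "\<dots> = C2 * C1 * v x" using vE(2)[of x] True d(2) by simp
      also have "\<dots> \<le> L * v x" using v01 by (intro mult_right_mono) (auto simp: L_def)
      finally show ?thesis .
    next
      case False
      have "v (g \<otimes>\<^bsub>G\<^esub> x \<otimes>\<^bsub>G\<^esub> inv\<^bsub>G\<^esub> g) \<le> 1 / d * d" using v01 d by simp
      also have "\<dots> \<le> L * v x" using False d by (intro mult_mono) (auto simp: L_def)
      finally show ?thesis .
    qed
    then show ?thesis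
      using 1(1,3) 2(1,3) 3(1,3) 4(1,2)
      by (intro exI[of _ "U1 \<inter> U2 \<inter> U3 \<inter> U4"] exI[of _ L]) (auto simp: L_def)
  qed
  have w_conj: "\<exists>V L. openin T V \<and> a \<in> V \<and> 1 \<le> L \<and>
      (\<forall>g\<in>V. \<forall>x\<in>carrier G. w (g \<otimes>\<^bsub>G\<^esub> x \<otimes>\<^bsub>G\<^esub> inv\<^bsub>G\<^esub> g) \<le> L * w x)" if a: "a \<in> carrier G" for a
  proof -
    obtain V L where V: "openin T V" "a \<in> V" "1 \<le> L"
      and L: "\<And>g x. g \<in> V \<Longrightarrow> x \<in> carrier G \<Longrightarrow> v (g \<otimes>\<^bsub>G\<^esub> x \<otimes>\<^bsub>G\<^esub> inv\<^bsub>G\<^esub> g) \<le> L * v x"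
      using v_conj[OF a] by blast
    have "w (g \<otimes>\<^bsub>G\<^esub> x \<otimes>\<^bsub>G\<^esub> inv\<^bsub>G\<^esub> g) \<le> L * w x" if gx: "g \<in> V" "x \<in> carrier G" for g x
    proof -
      have g: "g \<in> carrier G" using carr[OF V(1)] gx by auto
      have "inv\<^bsub>G\<^esub> (g \<otimes>\<^bsub>G\<^esub> x \<otimes>\<^bsub>G\<^esub> inv\<^bsub>G\<^esub> g) = g \<otimes>\<^bsub>G\<^esub> inv\<^bsub>G\<^esub> x \<otimes>\<^bsub>G\<^esub> inv\<^bsub>G\<^esub> g"
        using g gx by (simp add: inv_mult_group m_assoc)
      moreover have "L * v x \<le> L * w x" "L * v (inv\<^bsub>G\<^esub> x) \<le> L * w x"
        using V(3) by (auto simp: w_def intro: mult_left_mono)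
      ultimately show ?thesis
        using L[OF gx] L[OF gx(1) inv_closed[OF gx(2)]] by (simp add: w_def)
    qed
    with V show ?thesis by blast
  qed
  have w_sep: "\<exists>d>0. \<forall>xs. set xs \<subseteq> carrier G \<longrightarrow> sum_list (map w xs) < d \<longrightarrow> foldr (mult G) xs \<one>\<^bsub>G\<^esub> \<in> V"
    if V: "openin T V" "\<one>\<^bsub>G\<^esub> \<in> V" for V
  proof -
    obtain U1 V1 C1 where 1: "openin T U1" "openin T V1" "\<one>\<^bsub>G\<^esub> \<in> U1" "\<one>\<^bsub>G\<^esub> \<in> V1" "0 \<le> C1"
      and in_E: "\<And>x y. x \<in> U1 \<Longrightarrow> y \<in> V1 \<Longrightarrow> x \<otimes>\<^bsub>G\<^esub> y \<in> E"
      and lip: "\<And>x y x' y'. x \<in> U1 \<Longrightarrow> y \<in> V1 \<Longrightarrow> x' \<in> U1 \<Longrightarrow> y' \<in> V1 \<Longrightarrow>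
        norm (\<theta> (x \<otimes>\<^bsub>G\<^esub> y) - \<theta> (x' \<otimes>\<^bsub>G\<^esub> y')) \<le> C1 * (norm (\<theta> x - \<theta> x') + norm (\<theta> y - \<theta> y'))"
      by (rule banach_lie_group_mult_locally_lipschitz[OF G E(1) E(1) E(1) E(2) E(2)])
         (use E in simp_all)
    obtain d where d: "0 < d" "d \<le> 1" "\<And>x. v x < d \<Longrightarrow> x \<in> U1 \<inter> V1 \<inter> V"
      using v_base[of "U1 \<inter> V1 \<inter> V"] 1 V by blast
    define C where "C = max 1 C1"
    have C: "1 \<le> C" "C1 \<le> C" by (auto simp: C_def)
    \<comment> \<open>The Lipschitz constant must not accumulate along the word. Comparing
      \<open>x \<otimes> y\<close> with \<open>\<one> \<otimes> y\<close> charges it to the new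
      factor \<open>x\<close> only, while \<open>n y\<close> enters with coefficient
      \<open>1\<close>. The threshold \<open>d / C\<close> keeps every partial product where the
      estimate is valid.\<close>
    have key: "foldr (mult G) xs \<one>\<^bsub>G\<^esub> \<in> E \<and> n (foldr (mult G) xs \<one>\<^bsub>G\<^esub>) \<le> C * sum_list (map v xs)"
      if "set xs \<subseteq> carrier G" "sum_list (map v xs) < d / C" for xs
      using that
    proof (induction xs)
      case Nil
      then show ?case using E by (simp add: n_def)
    next
      case (Cons x xs)
      define y where "y = foldr (mult G) xs \<one>\<^bsub>G\<^esub>"
      have s: "0 \<le> sum_list (map v xs)" by (intro sum_list_nonneg) (use v01 in auto)
      have Cs: "C * (v x + sum_list (map v xs)) < d"
        using Cons.prems C by (simp add: field_simps)
      have IH: "y \<in> E" "n y \<le> C * sum_list (map v xs)"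
        using Cons.IH Cons.prems v01(1)[of x] by (auto simp: y_def)
      have yc: "y \<in> carrier G" using carr[OF \<theta>(1) IH(1)] .
      have Cv: "v x \<le> C * v x" "0 \<le> C * v x" "0 \<le> C * sum_list (map v xs)"
        using mult_right_mono[OF C(1), of "v x"] v01(1)[of x] C s by auto
      then have small: "v x < d" "n y < d"
        using Cs IH(2) by (auto simp: distrib_left)
      have x: "x \<in> U1" using d(3)[OF small(1)] by auto
      have y: "y \<in> V1" using d(3)[of y] small(2) by (simp add: v_def IH)
      have "n (x \<otimes>\<^bsub>G\<^esub> y) \<le> norm (\<theta> (x \<otimes>\<^bsub>G\<^esub> y) - \<theta> (\<one>\<^bsub>G\<^esub> \<otimes>\<^bsub>G\<^esub> y)) + n y"
        using norm_triangle_ineq[of "\<theta> (x \<otimes>\<^bsub>G\<^esub> y) - \<theta> y" "\<theta> y - \<theta> \<one>\<^bsub>G\<^esub>"] yc by (simp add: n_def)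
      also have "norm (\<theta> (x \<otimes>\<^bsub>G\<^esub> y) - \<theta> (\<one>\<^bsub>G\<^esub> \<otimes>\<^bsub>G\<^esub> y)) \<le> C1 * n x"
        using lip[OF x y 1(3) y] by (simp add: n_def)
      also have "C1 * n x \<le> C * v x"
        using C v01 vE(2)[of x] small(1) d(2) by (simp add: mult_right_mono n0)
      finally show ?case
        using in_E[OF x y] IH by (simp add: y_def distrib_left)
    qed
    show ?thesis
    proof (intro exI[of _ "d / C"] conjI allI impI)
      fix xs assume xs: "set xs \<subseteq> carrier G" "sum_list (map w xs) < d / C"
      have "sum_list (map v xs) \<le> sum_list (map w xs)"
        by (intro sum_list_mono) (simp add: w_def)
      then have s: "sum_list (map v xs) < d / C" using xs by simp
      then have "C * sum_list (map v xs) < d" using C by (simp add: field_simps)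
      with key[OF xs(1) s] have "v (foldr (mult G) xs \<one>\<^bsub>G\<^esub>) < d"
        by (auto simp: v_def)
      then show "foldr (mult G) xs \<one>\<^bsub>G\<^esub> \<in> V" using d(3) by blast
    qed (use d C in auto)
  qed
  have "conjugation_gauge G T w"
    unfolding conjugation_gauge_def
    using w_cont w_conj w_sep v01 by (auto simp: w_def max.commute le_max_iff_disj)
  then show thesis by (rule that)
qed

section \<open>Semidirect products of Hausdorff groups\<close>

definition semidirect_product ::
    "('f, 'y) monoid_scheme \<Rightarrow> ('g, 'x) monoid_scheme \<Rightarrow> ('g \<Rightarrow> 'f \<Rightarrow> 'f) \<Rightarrow> ('f \<times> 'g) monoid" where
  "semidirect_product F G act =
     \<lparr>carrier = carrier F \<times> carrier G,
      mult = (\<lambda>(x, g) (y, k). (x \<otimes>\<^bsub>F\<^esub> act g y, g \<otimes>\<^bsub>G\<^esub> k)),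
      one = (\<one>\<^bsub>F\<^esub>, \<one>\<^bsub>G\<^esub>)\<rparr>"

locale topological_group_action =
  fixes F :: "('f, 'y) monoid_scheme" and S G T and act :: "'g \<Rightarrow> 'f \<Rightarrow> 'f"
  assumes F: "hausdorff_group F S" and G: "hausdorff_group (G :: ('g, 'x) monoid_scheme) T"
    and act_hom: "\<And>g. g \<in> carrier G \<Longrightarrow> act g \<in> hom F F"
    and act_one: "\<And>x. x \<in> carrier F \<Longrightarrow> act \<one>\<^bsub>G\<^esub> x = x"
    and act_mult: "\<And>g k x. g \<in> carrier G \<Longrightarrow> k \<in> carrier G \<Longrightarrow> x \<in> carrier F \<Longrightarrow>
      act (g \<otimes>\<^bsub>G\<^esub> k) x = act g (act k x)"
    and act_cont: "continuous_map (prod_topology T S) S (\<lambda>(g, x). act g x)"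
begin

sublocale F: group F using F by (simp add: hausdorff_group_def)
sublocale G: group G using G by (simp add: hausdorff_group_def)

abbreviation "K \<equiv> semidirect_product F G act"

lemma carrier_K: "carrier K = carrier F \<times> carrier G"
  and mult_K: "(x, g) \<otimes>\<^bsub>K\<^esub> (y, k) = (x \<otimes>\<^bsub>F\<^esub> act g y, g \<otimes>\<^bsub>G\<^esub> k)"
  and one_K: "\<one>\<^bsub>K\<^esub> = (\<one>\<^bsub>F\<^esub>, \<one>\<^bsub>G\<^esub>)"
  by (simp_all add: semidirect_product_def)

lemma act_closed [simp]: "g \<in> carrier G \<Longrightarrow> x \<in> carrier F \<Longrightarrow> act g x \<in> carrier F"
  using act_hom by (auto simp: hom_def)

lemma act_distrib:
  "g \<in> carrier G \<Longrightarrow> x \<in> carrier F \<Longrightarrow> y \<in> carrier F \<Longrightarrow>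
    act g (x \<otimes>\<^bsub>F\<^esub> y) = act g x \<otimes>\<^bsub>F\<^esub> act g y"
  using act_hom by (auto simp: hom_def)

lemma act_unit [simp]: "g \<in> carrier G \<Longrightarrow> act g \<one>\<^bsub>F\<^esub> = \<one>\<^bsub>F\<^esub>"
  using act_hom[of g] F.is_group by (intro hom_one[of _ F F]) auto

lemma act_m_inv: "g \<in> carrier G \<Longrightarrow> x \<in> carrier F \<Longrightarrow> act g (inv\<^bsub>F\<^esub> x) = inv\<^bsub>F\<^esub> (act g x)"
  using act_hom[of g] group_hom.hom_inv[of F F "act g" x]
  by (simp add: group_hom_def group_hom_axioms_def F.is_group)

lemma group_K: "group K"
proof (rule groupI)
  fix p assume "p \<in> carrier K"
  then obtain x g where p: "p = (x, g)" "x \<in> carrier F" "g \<in> carrier G" by (auto simp: carrier_K)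
  then show "\<exists>q\<in>carrier K. q \<otimes>\<^bsub>K\<^esub> p = \<one>\<^bsub>K\<^esub>"
    by (intro bexI[of _ "(act (inv\<^bsub>G\<^esub> g) (inv\<^bsub>F\<^esub> x), inv\<^bsub>G\<^esub> g)"])
       (simp_all add: mult_K one_K carrier_K act_distrib[symmetric])
qed (auto simp: carrier_K mult_K one_K act_one act_mult act_distrib F.m_assoc G.m_assoc)

lemma inv_K:
  assumes "x \<in> carrier F" "g \<in> carrier G"
  shows "inv\<^bsub>K\<^esub> (x, g) = (act (inv\<^bsub>G\<^esub> g) (inv\<^bsub>F\<^esub> x), inv\<^bsub>G\<^esub> g)"
  by (rule group.inv_equality[OF group_K])
     (use assms in \<open>simp_all add: mult_K one_K carrier_K act_distrib[symmetric]\<close>)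

lemma continuous_map_act:
  assumes "continuous_map X T f" "continuous_map X S h"
  shows "continuous_map X S (\<lambda>x. act (f x) (h x))"
  using continuous_map_compose[OF continuous_map_pairedI[OF assms] act_cont] by (simp add: o_def)

lemma continuous_map_mult_F:
  assumes "continuous_map X S f" "continuous_map X S h"
  shows "continuous_map X S (\<lambda>x. f x \<otimes>\<^bsub>F\<^esub> h x)"
  using continuous_map_compose[OF continuous_map_pairedI[OF assms], of S "\<lambda>(x, y). x \<otimes>\<^bsub>F\<^esub> y"] F
  by (simp add: o_def hausdorff_group_def)

lemma continuous_map_mult_G:
  assumes "continuous_map X T f" "continuous_map X T h"
  shows "continuous_map X T (\<lambda>x. f x \<otimes>\<^bsub>G\<^esub> h x)"
  using continuous_map_compose[OF continuous_map_pairedI[OF assms], of T "\<lambda>(x, y). x \<otimes>\<^bsub>G\<^esub> y"] G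
  by (simp add: o_def hausdorff_group_def)

lemma continuous_map_inv_F:
  "continuous_map X S f \<Longrightarrow> continuous_map X S (\<lambda>x. inv\<^bsub>F\<^esub> f x)"
  using continuous_map_compose[of X S f S "\<lambda>x. inv\<^bsub>F\<^esub> x"] F
  by (simp add: o_def hausdorff_group_def)

lemma continuous_map_inv_G:
  "continuous_map X T f \<Longrightarrow> continuous_map X T (\<lambda>x. inv\<^bsub>G\<^esub> f x)"
  using continuous_map_compose[of X T f T "\<lambda>x. inv\<^bsub>G\<^esub> x"] G
  by (simp add: o_def hausdorff_group_def)

lemma topspaces: "topspace S = carrier F" "topspace T = carrier G"
  using F G by (auto simp: hausdorff_group_def)

lemma hausdorff_group_K: "hausdorff_group K (prod_topology S T)"
proof -
  have c: "continuous_map (prod_topology (prod_topology S T) (prod_topology S T)) S (\<lambda>p. fst (fst p))"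
    "continuous_map (prod_topology (prod_topology S T) (prod_topology S T)) T (\<lambda>p. snd (fst p))"
    "continuous_map (prod_topology (prod_topology S T) (prod_topology S T)) S (\<lambda>p. fst (snd p))"
    "continuous_map (prod_topology (prod_topology S T) (prod_topology S T)) T (\<lambda>p. snd (snd p))"
    using continuous_map_fst_of[OF continuous_map_fst] continuous_map_snd_of[OF continuous_map_fst]
      continuous_map_fst_of[OF continuous_map_snd] continuous_map_snd_of[OF continuous_map_snd]
    by (auto simp: o_def)
  have "continuous_map (prod_topology (prod_topology S T) (prod_topology S T)) (prod_topology S T)
      (\<lambda>p. (fst (fst p) \<otimes>\<^bsub>F\<^esub> act (snd (fst p)) (fst (snd p)), snd (fst p) \<otimes>\<^bsub>G\<^esub> snd (snd p)))"
    by (intro continuous_map_pairedI continuous_map_mult_F continuous_map_mult_G continuous_map_act c)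
  then have m: "continuous_map (prod_topology (prod_topology S T) (prod_topology S T)) (prod_topology S T)
      (\<lambda>(p, q). p \<otimes>\<^bsub>K\<^esub> q)"
    by (rule continuous_map_eq) (auto simp: mult_K)
  have "continuous_map (prod_topology S T) (prod_topology S T)
      (\<lambda>p. (act (inv\<^bsub>G\<^esub> snd p) (inv\<^bsub>F\<^esub> fst p), inv\<^bsub>G\<^esub> snd p))"
    by (intro continuous_map_pairedI continuous_map_act continuous_map_inv_F continuous_map_inv_G
        continuous_map_fst continuous_map_snd)
  then have i: "continuous_map (prod_topology S T) (prod_topology S T) (\<lambda>p. inv\<^bsub>K\<^esub> p)"
    by (rule continuous_map_eq) (auto simp: inv_K topspaces)
  show ?thesis
    using m i group_K F G
    by (simp add: hausdorff_group_def carrier_K Hausdorff_space_prod_topology)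
qed

lemma not_epi_if_fixed_point:
  assumes H: "subgroup H G" and f: "f \<in> carrier F" "\<And>h. h \<in> H \<Longrightarrow> act h f = f"
    and g: "g \<in> carrier G" "act g f \<noteq> f"
  shows "\<not> hausdorff_group_epi TYPE('f \<times> 'g) (G\<lparr>carrier := H\<rparr>) (subtopology T H) G T (\<lambda>x. x)"
proof
  assume epi: "hausdorff_group_epi TYPE('f \<times> 'g) (G\<lparr>carrier := H\<rparr>) (subtopology T H) G T (\<lambda>x. x)"
  define \<phi> where "\<phi> x = (\<one>\<^bsub>F\<^esub>, x)" for x :: 'g
  \<comment> \<open>This is
    \<open>(f, \<one>) \<otimes> (\<one>, x) \<otimes> inv (f, \<one>)\<close>, computed in
    \<open>K\<close>.\<close>
  define \<psi> where "\<psi> x = (f \<otimes>\<^bsub>F\<^esub> act x (inv\<^bsub>F\<^esub> f), x)" for x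
  have "hausdorff_group_hom G T K (prod_topology S T) \<phi>"
    unfolding hausdorff_group_hom_def \<phi>_def
    using G hausdorff_group_K
    by (auto simp: hom_def carrier_K mult_K topspaces intro!: continuous_map_pairedI continuous_map_id[unfolded id_def])
  moreover have "hausdorff_group_hom G T K (prod_topology S T) \<psi>"
  proof -
    have "\<psi> \<in> hom G K"
    proof (rule homI)
      fix x y assume xy: "x \<in> carrier G" "y \<in> carrier G"
      let ?a = "act x (inv\<^bsub>F\<^esub> f)" and ?b = "act x (act y (inv\<^bsub>F\<^esub> f))"
      have "f \<otimes>\<^bsub>F\<^esub> ?a \<otimes>\<^bsub>F\<^esub> act x (f \<otimes>\<^bsub>F\<^esub> act y (inv\<^bsub>F\<^esub> f)) = f \<otimes>\<^bsub>F\<^esub> (?a \<otimes>\<^bsub>F\<^esub> act x f) \<otimes>\<^bsub>F\<^esub> ?b"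
        using xy f by (simp add: act_distrib F.m_assoc)
      also have "?a \<otimes>\<^bsub>F\<^esub> act x f = \<one>\<^bsub>F\<^esub>"
        using xy f by (simp add: act_distrib[symmetric])
      finally show "\<psi> (x \<otimes>\<^bsub>G\<^esub> y) = \<psi> x \<otimes>\<^bsub>K\<^esub> \<psi> y"
        using xy f by (simp add: \<psi>_def mult_K act_mult)
    qed (use f in \<open>auto simp: \<psi>_def carrier_K\<close>)
    moreover have "continuous_map T (prod_topology S T) \<psi>"
      unfolding \<psi>_def
      by (intro continuous_map_pairedI continuous_map_mult_F continuous_map_act
          continuous_map_id[unfolded id_def])
         (use f in \<open>auto simp: topspaces\<close>)
    ultimately show ?thesis
      using G hausdorff_group_K by (simp add: hausdorff_group_hom_def)
  qed
  moreover have "\<forall>h\<in>carrier (G\<lparr>carrier := H\<rparr>). \<phi> h = \<psi> h"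
    using f subgroup.mem_carrier[OF H] by (simp add: \<phi>_def \<psi>_def act_m_inv)
  ultimately have "\<phi> g = \<psi> g"
    using epi g(1) unfolding hausdorff_group_epi_def by blast
  then have "f \<otimes>\<^bsub>F\<^esub> inv\<^bsub>F\<^esub> (act g f) = \<one>\<^bsub>F\<^esub>"
    using f g by (simp add: \<phi>_def \<psi>_def act_m_inv)
  then have "f = act g f"
    using f g by (metis F.inv_closed F.inv_equality F.inv_inv act_closed)
  with g show False by simp
qed

end

section \<open>Functionals on Lipschitz functions\<close>

locale gauged_group = group G for G :: "('g, 'x) monoid_scheme" (structure) +
  fixes T :: "'g topology" and w :: "'g \<Rightarrow> real" and H :: "'g set"
  assumes hausdorff: "hausdorff_group G T"
    and gauge: "conjugation_gauge G T w"
    and H: "subgroup H G"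
begin

lemma topspace_G: "topspace T = carrier G"
  using hausdorff by (simp add: hausdorff_group_def)

lemma open_carrier: "openin T V \<Longrightarrow> x \<in> V \<Longrightarrow> x \<in> carrier G"
  using openin_subset topspace_G by blast

lemma H_closed: "h \<in> H \<Longrightarrow> h \<in> carrier G"
  by (rule subgroup.mem_carrier[OF H])

lemma gauge_bounds: "x \<in> carrier G \<Longrightarrow> 0 \<le> w x" "x \<in> carrier G \<Longrightarrow> w x \<le> 1"
  and gauge_inv: "x \<in> carrier G \<Longrightarrow> w (inv x) = w x"
  using gauge by (auto simp: conjugation_gauge_def)

lemma gauge_small:
  assumes "0 < e"
  obtains V where "openin T V" "\<one> \<in> V" "\<And>x. x \<in> V \<Longrightarrow> w x < e"
  using gauge assms unfolding conjugation_gauge_def by meson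

lemma gauge_conj:
  assumes "a \<in> carrier G"
  obtains V L where "openin T V" "a \<in> V" "1 \<le> L"
    "\<And>g x. g \<in> V \<Longrightarrow> x \<in> carrier G \<Longrightarrow> w (g \<otimes> x \<otimes> inv g) \<le> L * w x"
  using gauge assms unfolding conjugation_gauge_def by meson

lemma gauge_separates:
  assumes "openin T V" "\<one> \<in> V"
  obtains d where "0 < d"
    "\<And>xs. set xs \<subseteq> carrier G \<Longrightarrow> sum_list (map w xs) < d \<Longrightarrow> foldr (mult G) xs \<one> \<in> V"
  using gauge assms unfolding conjugation_gauge_def by meson

text \<open>
  These are the functions on \<open>G / H\<close> with Lipschitz constant one for the metric generated by the
  gauge, lifted to \<open>G\<close>.
\<close>
definition unit_lipschitz :: "('g \<Rightarrow> real) set" where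
  "unit_lipschitz = {u. (\<forall>x. x \<notin> carrier G \<longrightarrow> u x = 0) \<and>
     (\<forall>x\<in>carrier G. \<bar>u x\<bar> \<le> 1 \<and> (\<forall>h\<in>H. u (x \<otimes> h) = u x) \<and>
        (\<forall>z\<in>carrier G. \<bar>u (z \<otimes> x) - u x\<bar> \<le> w z))}"

text \<open>Translations do not preserve \<open>unit_lipschitz\<close> but scale its Lipschitz
  bound; this enlargement is invariant under them, so that functionals can be evaluated on
  translates.\<close>

definition lipschitz_cone :: "('g \<Rightarrow> real) set" where
  "lipschitz_cone = {\<lambda>x. c * u x |c u. 0 < c \<and> u \<in> unit_lipschitz}"

text \<open>A right action on functions: \<open>shift k \<circ> shift g\<close> is
  \<open>shift (g \<otimes> k)\<close> on group elements. The dual action on functionals is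
  therefore a left action.\<close>

definition shift :: "'g \<Rightarrow> ('g \<Rightarrow> real) \<Rightarrow> 'g \<Rightarrow> real" where
  "shift g u = (\<lambda>x. if x \<in> carrier G then u (g \<otimes> x) else 0)"

section \<open>Translation of Lipschitz functions\<close>

lemma unit_lipschitzD:
  assumes "u \<in> unit_lipschitz"
  shows "x \<notin> carrier G \<Longrightarrow> u x = 0"
    and "x \<in> carrier G \<Longrightarrow> \<bar>u x\<bar> \<le> 1"
    and "x \<in> carrier G \<Longrightarrow> h \<in> H \<Longrightarrow> u (x \<otimes> h) = u x"
    and "x \<in> carrier G \<Longrightarrow> z \<in> carrier G \<Longrightarrow> \<bar>u (z \<otimes> x) - u x\<bar> \<le> w z"
  using assms by (auto simp: unit_lipschitz_def)

lemma zero_unit_lipschitz: "(\<lambda>_. 0) \<in> unit_lipschitz"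
  by (simp add: unit_lipschitz_def gauge_bounds)

lemma lipschitz_coneI: "0 < c \<Longrightarrow> u \<in> unit_lipschitz \<Longrightarrow> (\<lambda>x. c * u x) \<in> lipschitz_cone"
  by (auto simp: lipschitz_cone_def)

lemma unit_lipschitz_cone: "u \<in> unit_lipschitz \<Longrightarrow> u \<in> lipschitz_cone"
  using lipschitz_coneI[of 1 u] by simp

lemma lipschitz_coneE:
  assumes "u \<in> lipschitz_cone"
  obtains c v where "0 < c" "v \<in> unit_lipschitz" "u = (\<lambda>x. c * v x)"
  using assms by (auto simp: lipschitz_cone_def)

lemma lipschitz_cone_scale:
  assumes "u \<in> lipschitz_cone" "0 < c"
  shows "(\<lambda>x. c * u x) \<in> lipschitz_cone"
proof -
  obtain b v where "0 < b" "v \<in> unit_lipschitz" "u = (\<lambda>x. b * v x)"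
    using assms(1) by (rule lipschitz_coneE)
  then show ?thesis
    using lipschitz_coneI[of "c * b" v] assms(2) by (simp add: mult.assoc)
qed

lemma shift_scale: "shift g (\<lambda>x. c * u x) = (\<lambda>x. c * shift g u x)"
  by (auto simp: shift_def)

lemma shift_shift:
  assumes "g \<in> carrier G" "k \<in> carrier G"
  shows "shift k (shift g u) = shift (g \<otimes> k) u"
  using assms by (auto simp: shift_def m_assoc)

lemma shift_one: "u \<in> lipschitz_cone \<Longrightarrow> shift \<one> u = u"
  by (auto simp: shift_def lipschitz_cone_def unit_lipschitz_def)

text \<open>Since \<open>g \<otimes> (z \<otimes> x) = (g \<otimes> z \<otimes> inv g) \<otimes> (g
  \<otimes> x)\<close>, an increment by \<open>z\<close> of the translate is an increment of
  \<open>u\<close> by the conjugate of \<open>z\<close>. The condition \<open>1 \<le> L\<close>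
  preserves the bound \<open>1\<close> on the values after division.\<close>

lemma shift_unit_lipschitz:
  assumes g: "g \<in> carrier G" and L: "1 \<le> L" "\<And>x. x \<in> carrier G \<Longrightarrow> w (g \<otimes> x \<otimes> inv g) \<le> L * w x"
    and u: "u \<in> unit_lipschitz"
  shows "(\<lambda>x. shift g u x / L) \<in> unit_lipschitz"
proof -
  have "\<bar>u (g \<otimes> x) / L\<bar> \<le> 1" if "x \<in> carrier G" for x
    using unit_lipschitzD(2)[OF u, of "g \<otimes> x"] g L(1) that by (simp add: abs_divide)
  moreover have "u (g \<otimes> (x \<otimes> h)) = u (g \<otimes> x)" if "x \<in> carrier G" "h \<in> H" for x h
    using unit_lipschitzD(3)[OF u, of "g \<otimes> x" h] g that H_closed by (simp add: m_assoc)
  moreover have "\<bar>u (g \<otimes> (z \<otimes> x)) / L - u (g \<otimes> x) / L\<bar> \<le> w z"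
    if xz: "x \<in> carrier G" "z \<in> carrier G" for x z
  proof -
    have "g \<otimes> z \<otimes> inv g \<otimes> (g \<otimes> x) = g \<otimes> z \<otimes> (inv g \<otimes> g) \<otimes> x"
      using g xz by (simp only: m_assoc m_closed inv_closed)
    then have "g \<otimes> z \<otimes> inv g \<otimes> (g \<otimes> x) = g \<otimes> (z \<otimes> x)"
      using g xz by (simp add: m_assoc)
    then have "\<bar>u (g \<otimes> (z \<otimes> x)) - u (g \<otimes> x)\<bar> \<le> L * w z"
      using unit_lipschitzD(4)[OF u, of "g \<otimes> x" "g \<otimes> z \<otimes> inv g"] L(2)[of z] g xz by simp
    then show ?thesis
      using L(1) by (simp add: diff_divide_distrib[symmetric] abs_divide pos_divide_le_eq mult.commute)
  qed
  ultimately show ?thesis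
    using H_closed by (auto simp: unit_lipschitz_def shift_def)
qed

lemma shift_lipschitz_cone:
  assumes g: "g \<in> carrier G" and u: "u \<in> lipschitz_cone"
  shows "shift g u \<in> lipschitz_cone"
proof -
  obtain c v where c: "0 < c" and v: "v \<in> unit_lipschitz" "u = (\<lambda>x. c * v x)"
    using u by (rule lipschitz_coneE)
  obtain V L where L: "g \<in> V" "1 \<le> L"
    "\<And>g x. g \<in> V \<Longrightarrow> x \<in> carrier G \<Longrightarrow> w (g \<otimes> x \<otimes> inv g) \<le> L * w x"
    using gauge_conj[OF g] by metis
  have "(\<lambda>x. c * L * (shift g v x / L)) \<in> lipschitz_cone"
    using c L by (intro lipschitz_coneI shift_unit_lipschitz[OF g] v) auto
  then show ?thesis using L(2) v(2) by (simp add: shift_scale)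
qed

text \<open>
  Homogeneity is all that is needed of linearity: translations map \<^term>\<open>unit_lipschitz\<close> to a
  multiple of itself. The value \<open>0\<close> off the cone makes functionals that agree on
  \<^term>\<open>unit_lipschitz\<close> equal.
\<close>
definition functionals :: "(('g \<Rightarrow> real) \<Rightarrow> real) set" where
  "functionals = {\<mu>. (\<forall>u. u \<notin> lipschitz_cone \<longrightarrow> \<mu> u = 0) \<and>
     (\<forall>c>0. \<forall>u\<in>lipschitz_cone. \<mu> (\<lambda>x. c * u x) = c * \<mu> u) \<and>
     (\<exists>B. \<forall>u\<in>unit_lipschitz. \<bar>\<mu> u\<bar> \<le> B) \<and>
     (\<forall>a\<in>carrier G. \<forall>e>0. \<exists>V. openin T V \<and> a \<in> V \<and>
        (\<forall>g\<in>V. \<forall>u\<in>unit_lipschitz. \<bar>\<mu> (shift g u) - \<mu> (shift a u)\<bar> \<le> e))}"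

definition functional_group :: "(('g \<Rightarrow> real) \<Rightarrow> real) monoid" where
  "functional_group = \<lparr>carrier = functionals, mult = (\<lambda>\<mu> \<nu> u. \<mu> u + \<nu> u), one = (\<lambda>_. 0)\<rparr>"

text \<open>The dual norm of the difference. The outer absolute value makes it nonnegative for all
  arguments, also where the supremum is not over a bounded set, since \<open>Metric_space\<close>
  asks for nonnegativity without membership.\<close>

definition functional_dist :: "(('g \<Rightarrow> real) \<Rightarrow> real) \<Rightarrow> (('g \<Rightarrow> real) \<Rightarrow> real) \<Rightarrow> real" where
  "functional_dist \<mu> \<nu> = \<bar>SUP u\<in>unit_lipschitz. \<bar>\<mu> u - \<nu> u\<bar>\<bar>"

text \<open>The action that moves evaluation at \<open>x\<close> to evaluation at
  \<open>g \<otimes> x\<close>. The value \<open>0\<close> off the cone retains the normal form of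
  functionals.\<close>

definition functional_act :: "'g \<Rightarrow> (('g \<Rightarrow> real) \<Rightarrow> real) \<Rightarrow> ('g \<Rightarrow> real) \<Rightarrow> real" where
  "functional_act g \<mu> = (\<lambda>u. if u \<in> lipschitz_cone then \<mu> (shift g u) else 0)"

lemma functionalsD:
  assumes "\<mu> \<in> functionals"
  shows "u \<notin> lipschitz_cone \<Longrightarrow> \<mu> u = 0"
    and "0 < c \<Longrightarrow> u \<in> lipschitz_cone \<Longrightarrow> \<mu> (\<lambda>x. c * u x) = c * \<mu> u"
  using assms by (auto simp: functionals_def)

lemma functionals_bounded:
  assumes "\<mu> \<in> functionals"
  obtains B where "\<And>u. u \<in> unit_lipschitz \<Longrightarrow> \<bar>\<mu> u\<bar> \<le> B"
proof -
  have "\<exists>B. \<forall>u\<in>unit_lipschitz. \<bar>\<mu> u\<bar> \<le> B"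
    using assms by (simp add: functionals_def)
  then show thesis using that by blast
qed

lemma functionals_orbit:
  assumes "\<mu> \<in> functionals" "a \<in> carrier G" "0 < e"
  obtains V where "openin T V" "a \<in> V"
    "\<And>g u. g \<in> V \<Longrightarrow> u \<in> unit_lipschitz \<Longrightarrow> \<bar>\<mu> (shift g u) - \<mu> (shift a u)\<bar> \<le> e"
proof -
  have "\<exists>V. openin T V \<and> a \<in> V \<and>
        (\<forall>g\<in>V. \<forall>u\<in>unit_lipschitz. \<bar>\<mu> (shift g u) - \<mu> (shift a u)\<bar> \<le> e)"
    using assms by (simp add: functionals_def)
  then show thesis using that by blast
qed

lemma functional_group_simps:
  "carrier functional_group = functionals"
  "\<mu> \<otimes>\<^bsub>functional_group\<^esub> \<nu> = (\<lambda>u. \<mu> u + \<nu> u)" "\<one>\<^bsub>functional_group\<^esub> = (\<lambda>_. 0)"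
  by (simp_all add: functional_group_def)

lemma zero_functionals: "(\<lambda>_. 0) \<in> functionals"
  using openin_topspace[of T] topspace_G by (auto simp: functionals_def)

lemma add_functionals:
  assumes "\<mu> \<in> functionals" "\<nu> \<in> functionals"
  shows "(\<lambda>u. \<mu> u + \<nu> u) \<in> functionals"
proof -
  obtain B C where B: "\<And>u. u \<in> unit_lipschitz \<Longrightarrow> \<bar>\<mu> u\<bar> \<le> B"
    and C: "\<And>u. u \<in> unit_lipschitz \<Longrightarrow> \<bar>\<nu> u\<bar> \<le> C"
    using assms by (metis functionals_bounded)
  have "\<bar>\<mu> u + \<nu> u\<bar> \<le> B + C" if "u \<in> unit_lipschitz" for u
    using B[OF that] C[OF that] by linarith
  moreover have "\<exists>V. openin T V \<and> a \<in> V \<and> (\<forall>g\<in>V. \<forall>u\<in>unit_lipschitz.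
      \<bar>\<mu> (shift g u) + \<nu> (shift g u) - (\<mu> (shift a u) + \<nu> (shift a u))\<bar> \<le> e)"
    if a: "a \<in> carrier G" and "0 < e" for a e
  proof -
    have e: "0 < e / 2" using that by simp
    obtain V1 where V1: "openin T V1" "a \<in> V1"
      "\<And>g u. g \<in> V1 \<Longrightarrow> u \<in> unit_lipschitz \<Longrightarrow> \<bar>\<mu> (shift g u) - \<mu> (shift a u)\<bar> \<le> e / 2"
      by (rule functionals_orbit[OF assms(1) a e]) (rule that)
    obtain V2 where V2: "openin T V2" "a \<in> V2"
      "\<And>g u. g \<in> V2 \<Longrightarrow> u \<in> unit_lipschitz \<Longrightarrow> \<bar>\<nu> (shift g u) - \<nu> (shift a u)\<bar> \<le> e / 2"
      by (rule functionals_orbit[OF assms(2) a e]) (rule that)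
    have "\<bar>\<mu> (shift g u) + \<nu> (shift g u) - (\<mu> (shift a u) + \<nu> (shift a u))\<bar> \<le> e"
      if "g \<in> V1 \<inter> V2" "u \<in> unit_lipschitz" for g u
    proof -
      have "\<bar>\<mu> (shift g u) - \<mu> (shift a u)\<bar> \<le> e / 2"
        by (rule V1(3)) (use that in auto)
      moreover have "\<bar>\<nu> (shift g u) - \<nu> (shift a u)\<bar> \<le> e / 2"
        by (rule V2(3)) (use that in auto)
      ultimately show ?thesis by linarith
    qed
    then show ?thesis using V1 V2 by (intro exI[of _ "V1 \<inter> V2"]) auto
  qed
  ultimately show ?thesis
    using assms by (auto simp: functionals_def distrib_left)
qed

lemma minus_functionals: "\<mu> \<in> functionals \<Longrightarrow> (\<lambda>u. - \<mu> u) \<in> functionals"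
  by (auto simp: functionals_def abs_minus_commute)

text \<open>Boundedness comes from rescaling a translate into \<open>unit_lipschitz\<close>.
  Continuity of the orbit of the translated functional at \<open>a\<close> is continuity of the
  orbit of \<open>\<mu>\<close> at \<open>a \<otimes> k\<close>.\<close>

lemma functional_act_closed:
  assumes k: "k \<in> carrier G" and \<mu>: "\<mu> \<in> functionals"
  shows "functional_act k \<mu> \<in> functionals"
proof -
  obtain V L where L: "k \<in> V" "1 \<le> L"
    "\<And>g x. g \<in> V \<Longrightarrow> x \<in> carrier G \<Longrightarrow> w (g \<otimes> x \<otimes> inv g) \<le> L * w x"
    using gauge_conj[OF k] by metis
  obtain B where B: "\<And>u. u \<in> unit_lipschitz \<Longrightarrow> \<bar>\<mu> u\<bar> \<le> B"
    by (rule functionals_bounded[OF \<mu>]) (rule that)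
  have "\<bar>functional_act k \<mu> u\<bar> \<le> L * B" if u: "u \<in> unit_lipschitz" for u
  proof -
    let ?v = "\<lambda>x. shift k u x / L"
    have v: "?v \<in> unit_lipschitz" by (rule shift_unit_lipschitz[OF k]) (use L u in auto)
    have "\<mu> (shift k u) = L * \<mu> ?v"
      using functionalsD(2)[OF \<mu> _ unit_lipschitz_cone[OF v], of L] L(2) by simp
    then show ?thesis
      using B[OF v] L(2) u by (simp add: functional_act_def unit_lipschitz_cone abs_mult)
  qed
  moreover have "\<exists>V. openin T V \<and> a \<in> V \<and> (\<forall>g\<in>V. \<forall>u\<in>unit_lipschitz.
      \<bar>functional_act k \<mu> (shift g u) - functional_act k \<mu> (shift a u)\<bar> \<le> e)"
    if a: "a \<in> carrier G" and e: "0 < e" for a e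
  proof -
    obtain V where V: "openin T V" "a \<otimes> k \<in> V"
      "\<And>g u. g \<in> V \<Longrightarrow> u \<in> unit_lipschitz \<Longrightarrow> \<bar>\<mu> (shift g u) - \<mu> (shift (a \<otimes> k) u)\<bar> \<le> e"
      by (rule functionals_orbit[OF \<mu> m_closed[OF a k] e]) (rule that)
    obtain V1 V2 where V1: "openin T V1" "a \<in> V1" "k \<in> V2" "\<And>x y. x \<in> V1 \<Longrightarrow> y \<in> V2 \<Longrightarrow> x \<otimes> y \<in> V"
      using hausdorff_group_mult_nhds[OF hausdorff V(1) a k V(2)] by metis
    have "\<bar>functional_act k \<mu> (shift g u) - functional_act k \<mu> (shift a u)\<bar> \<le> e"
      if g: "g \<in> V1" and u: "u \<in> unit_lipschitz" for g u
      using V(3)[OF V1(4)[OF g V1(3)] u] open_carrier[OF V1(1) g] a k u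
      by (simp add: functional_act_def shift_lipschitz_cone unit_lipschitz_cone shift_shift)
    then show ?thesis using V1 by blast
  qed
  moreover have "functional_act k \<mu> (\<lambda>x. c * u x) = c * functional_act k \<mu> u"
    if "0 < c" "u \<in> lipschitz_cone" for c u
    using that k functionalsD(2)[OF \<mu>]
    by (simp add: functional_act_def shift_scale lipschitz_cone_scale shift_lipschitz_cone)
  moreover have "functional_act k \<mu> u = 0" if "u \<notin> lipschitz_cone" for u
    using that by (simp add: functional_act_def)
  ultimately show ?thesis
    unfolding functionals_def by blast
qed

section \<open>The metric group of functionals and the action on it\<close>

lemma functional_dist_ge:
  assumes "\<mu> \<in> functionals" "\<nu> \<in> functionals" "u \<in> unit_lipschitz"
  shows "\<bar>\<mu> u - \<nu> u\<bar> \<le> functional_dist \<mu> \<nu>"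
proof -
  obtain B C where B: "\<And>u. u \<in> unit_lipschitz \<Longrightarrow> \<bar>\<mu> u\<bar> \<le> B"
    and C: "\<And>u. u \<in> unit_lipschitz \<Longrightarrow> \<bar>\<nu> u\<bar> \<le> C"
    using assms(1,2) by (metis functionals_bounded)
  have "\<bar>\<mu> u - \<nu> u\<bar> \<le> B + C" if "u \<in> unit_lipschitz" for u
    using B[OF that] C[OF that] by linarith
  then have "bdd_above ((\<lambda>u. \<bar>\<mu> u - \<nu> u\<bar>) ` unit_lipschitz)"
    by (rule bdd_aboveI2)
  from cSUP_upper[OF assms(3) this] show ?thesis
    by (simp add: functional_dist_def)
qed

lemma functional_dist_le:
  assumes "\<And>u. u \<in> unit_lipschitz \<Longrightarrow> \<bar>\<mu> u - \<nu> u\<bar> \<le> e"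
  shows "functional_dist \<mu> \<nu> \<le> e"
proof -
  have ne: "unit_lipschitz \<noteq> {}" using zero_unit_lipschitz by blast
  have "(SUP u\<in>unit_lipschitz. \<bar>\<mu> u - \<nu> u\<bar>) \<le> e"
    by (rule cSUP_least[OF ne assms])
  moreover have "0 \<le> (SUP u\<in>unit_lipschitz. \<bar>\<mu> u - \<nu> u\<bar>)"
    by (rule cSUP_upper2[OF _ zero_unit_lipschitz]) (auto intro!: bdd_aboveI2[of _ _ e] assms)
  ultimately show ?thesis by (simp add: functional_dist_def)
qed

lemma functionals_eqI:
  assumes "\<mu> \<in> functionals" "\<nu> \<in> functionals" "\<And>u. u \<in> unit_lipschitz \<Longrightarrow> \<mu> u = \<nu> u"
  shows "\<mu> = \<nu>"
proof
  fix u
  show "\<mu> u = \<nu> u"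
  proof (cases "u \<in> lipschitz_cone")
    case True
    then obtain c v where "0 < c" "v \<in> unit_lipschitz" "u = (\<lambda>x. c * v x)"
      by (rule lipschitz_coneE)
    then show ?thesis
      using functionalsD(2)[OF assms(1), of c v] functionalsD(2)[OF assms(2), of c v] assms(3)[of v]
      by (simp add: unit_lipschitz_cone)
  qed (simp add: functionalsD(1)[OF assms(1)] functionalsD(1)[OF assms(2)])
qed

sublocale functional: Metric_space functionals functional_dist
proof
  show "0 \<le> functional_dist \<mu> \<nu>" for \<mu> \<nu> by (simp add: functional_dist_def)
  show "functional_dist \<mu> \<nu> = functional_dist \<nu> \<mu>" for \<mu> \<nu>
    by (simp add: functional_dist_def abs_minus_commute)
  show "functional_dist \<mu> \<nu> = 0 \<longleftrightarrow> \<mu> = \<nu>" if "\<mu> \<in> functionals" "\<nu> \<in> functionals" for \<mu> \<nu>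
  proof
    assume "functional_dist \<mu> \<nu> = 0"
    then show "\<mu> = \<nu>"
      using functional_dist_ge[OF that] by (intro functionals_eqI that) fastforce
  next
    have "functional_dist \<mu> \<mu> \<le> 0" by (rule functional_dist_le) simp
    then show "\<mu> = \<nu> \<Longrightarrow> functional_dist \<mu> \<nu> = 0" by (simp add: functional_dist_def)
  qed
  show "functional_dist \<mu> \<xi> \<le> functional_dist \<mu> \<nu> + functional_dist \<nu> \<xi>"
    if "\<mu> \<in> functionals" "\<nu> \<in> functionals" "\<xi> \<in> functionals" for \<mu> \<nu> \<xi>
  proof (rule functional_dist_le)
    fix u assume "u \<in> unit_lipschitz"
    then show "\<bar>\<mu> u - \<xi> u\<bar> \<le> functional_dist \<mu> \<nu> + functional_dist \<nu> \<xi>"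
      using functional_dist_ge[OF that(1,2), of u] functional_dist_ge[OF that(2,3), of u] by linarith
  qed
qed

lemma group_functional_group: "group functional_group"
proof (rule groupI)
  fix \<mu> assume "\<mu> \<in> carrier functional_group"
  then show "\<exists>\<nu>\<in>carrier functional_group. \<nu> \<otimes>\<^bsub>functional_group\<^esub> \<mu> = \<one>\<^bsub>functional_group\<^esub>"
    by (intro bexI[of _ "\<lambda>u. - \<mu> u"]) (auto simp: functional_group_simps minus_functionals)
qed (auto simp: functional_group_simps add_functionals zero_functionals)

lemma inv_functional_group:
  assumes "\<mu> \<in> functionals"
  shows "inv\<^bsub>functional_group\<^esub> \<mu> = (\<lambda>u. - \<mu> u)"
  by (rule group.inv_equality[OF group_functional_group])
     (use assms in \<open>auto simp: functional_group_simps minus_functionals\<close>)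

lemma hausdorff_functional_group: "hausdorff_group functional_group functional.mtopology"
proof -
  have "continuous_map (prod_topology functional.mtopology functional.mtopology) functional.mtopology
      (\<lambda>(\<mu>, \<nu>). \<mu> \<otimes>\<^bsub>functional_group\<^esub> \<nu>)"
    unfolding functional.continuous_map_to_metric
  proof (intro ballI allI impI)
    fix p and e :: real
    assume "p \<in> topspace (prod_topology functional.mtopology functional.mtopology)" and e: "0 < e"
    then obtain \<mu> \<nu> where p: "p = (\<mu>, \<nu>)" "\<mu> \<in> functionals" "\<nu> \<in> functionals" by auto
    let ?V = "functional.mball \<mu> (e / 3) \<times> functional.mball \<nu> (e / 3)"
    have "functional_dist (\<lambda>u. \<mu> u + \<nu> u) (\<lambda>u. \<mu>' u + \<nu>' u) < e"
      if "(\<mu>', \<nu>') \<in> ?V" for \<mu>' \<nu>'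
    proof -
      have "functional_dist (\<lambda>u. \<mu> u + \<nu> u) (\<lambda>u. \<mu>' u + \<nu>' u) \<le> e / 3 + e / 3"
      proof (rule functional_dist_le)
        fix u assume u: "u \<in> unit_lipschitz"
        have "\<bar>\<mu> u - \<mu>' u\<bar> \<le> functional_dist \<mu> \<mu>'" "\<bar>\<nu> u - \<nu>' u\<bar> \<le> functional_dist \<nu> \<nu>'"
          using that by (auto intro!: functional_dist_ge u)
        moreover have "functional_dist \<mu> \<mu>' < e / 3" "functional_dist \<nu> \<nu>' < e / 3"
          using that by auto
        ultimately show "\<bar>\<mu> u + \<nu> u - (\<mu>' u + \<nu>' u)\<bar> \<le> e / 3 + e / 3"
          by linarith
      qed
      then show ?thesis using e by simp
    qed
    then show "\<exists>V. openin (prod_topology functional.mtopology functional.mtopology) V \<and> p \<in> V \<and>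
        (\<forall>q\<in>V. (case q of (\<mu>, \<nu>) \<Rightarrow> \<mu> \<otimes>\<^bsub>functional_group\<^esub> \<nu>)
           \<in> functional.mball (case p of (\<mu>, \<nu>) \<Rightarrow> \<mu> \<otimes>\<^bsub>functional_group\<^esub> \<nu>) e)"
      using p e
      by (intro exI[of _ ?V])
         (auto simp: functional_group_simps add_functionals openin_prod_Times_iff)
  qed
  moreover have "continuous_map functional.mtopology functional.mtopology (\<lambda>\<mu>. inv\<^bsub>functional_group\<^esub> \<mu>)"
    unfolding functional.continuous_map_to_metric
  proof (intro ballI allI impI)
    fix \<mu> and e :: real
    assume "\<mu> \<in> topspace functional.mtopology" and e: "0 < e"
    then have \<mu>: "\<mu> \<in> functionals" by simp
    have "functional_dist (\<lambda>u. - \<mu> u) (\<lambda>u. - \<nu> u) = functional_dist \<mu> \<nu>" for \<nu>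
      by (simp add: functional_dist_def abs_minus_commute)
    then show "\<exists>V. openin functional.mtopology V \<and> \<mu> \<in> V \<and>
        (\<forall>\<nu>\<in>V. inv\<^bsub>functional_group\<^esub> \<nu> \<in> functional.mball (inv\<^bsub>functional_group\<^esub> \<mu>) e)"
      using \<mu> e by (intro exI[of _ "functional.mball \<mu> e"])
        (auto simp: inv_functional_group minus_functionals)
  qed
  ultimately show ?thesis
    by (simp add: hausdorff_group_def group_functional_group functional.Hausdorff_space_mtopology
        functional_group_simps)
qed

lemma functional_act_dist_le:
  assumes g: "g \<in> carrier G" and L: "1 \<le> L" "\<And>x. x \<in> carrier G \<Longrightarrow> w (g \<otimes> x \<otimes> inv g) \<le> L * w x"
    and \<mu>: "\<mu> \<in> functionals" "\<nu> \<in> functionals"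
  shows "functional_dist (functional_act g \<mu>) (functional_act g \<nu>) \<le> L * functional_dist \<mu> \<nu>"
proof (rule functional_dist_le)
  fix u assume u: "u \<in> unit_lipschitz"
  let ?v = "\<lambda>x. shift g u x / L"
  have v: "?v \<in> unit_lipschitz" by (rule shift_unit_lipschitz[OF g L u])
  have "\<mu> (shift g u) = L * \<mu> ?v" "\<nu> (shift g u) = L * \<nu> ?v"
    using functionalsD(2)[OF \<mu>(1) _ unit_lipschitz_cone[OF v], of L]
      functionalsD(2)[OF \<mu>(2) _ unit_lipschitz_cone[OF v], of L] L(1) by auto
  then have "\<bar>functional_act g \<mu> u - functional_act g \<nu> u\<bar> = L * \<bar>\<mu> ?v - \<nu> ?v\<bar>"
    using u L(1) by (simp add: functional_act_def unit_lipschitz_cone right_diff_distrib[symmetric] abs_mult)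
  also have "\<dots> \<le> L * functional_dist \<mu> \<nu>"
    using functional_dist_ge[OF \<mu> v] L(1) by (intro mult_left_mono) auto
  finally show "\<bar>functional_act g \<mu> u - functional_act g \<nu> u\<bar> \<le> L * functional_dist \<mu> \<nu>" .
qed

sublocale functional: topological_group_action functional_group functional.mtopology G T functional_act
proof
  show "hausdorff_group functional_group functional.mtopology" by (rule hausdorff_functional_group)
  show "hausdorff_group G T" by (rule hausdorff)
  show "functional_act g \<in> hom functional_group functional_group" if "g \<in> carrier G" for g
  proof (rule homI)
    fix \<mu> \<nu>
    show "functional_act g (\<mu> \<otimes>\<^bsub>functional_group\<^esub> \<nu>)
        = functional_act g \<mu> \<otimes>\<^bsub>functional_group\<^esub> functional_act g \<nu>"
      by (auto simp: functional_group_simps functional_act_def)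
  qed (use that functional_act_closed in \<open>simp add: functional_group_simps\<close>)
  show "functional_act \<one> \<mu> = \<mu>" if "\<mu> \<in> carrier functional_group" for \<mu>
    using that functionalsD(1)[of \<mu>]
    by (auto simp: functional_act_def functional_group_simps shift_one fun_eq_iff)
  show "functional_act (g \<otimes> k) \<mu> = functional_act g (functional_act k \<mu>)"
    if "g \<in> carrier G" "k \<in> carrier G" for g k \<mu>
    using that by (auto simp: functional_act_def shift_shift shift_lipschitz_cone fun_eq_iff)
  show "continuous_map (prod_topology T functional.mtopology) functional.mtopology
      (\<lambda>(g, \<mu>). functional_act g \<mu>)"
    unfolding functional.continuous_map_to_metric
  proof (intro ballI allI impI)
    fix p and e :: real
    assume "p \<in> topspace (prod_topology T functional.mtopology)" and e: "0 < e"
    then obtain a \<mu> where p: "p = (a, \<mu>)" and a: "a \<in> carrier G" and \<mu>: "\<mu> \<in> functionals"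
      by (auto simp: topspace_G)
    obtain V L where V: "openin T V" "a \<in> V" and L: "1 \<le> L"
      "\<And>g x. g \<in> V \<Longrightarrow> x \<in> carrier G \<Longrightarrow> w (g \<otimes> x \<otimes> inv g) \<le> L * w x"
      by (rule gauge_conj[OF a]) (rule that)
    have e3: "0 < e / 3" using e by simp
    obtain V' where V': "openin T V'" "a \<in> V'"
      and orbit: "\<And>g u. g \<in> V' \<Longrightarrow> u \<in> unit_lipschitz \<Longrightarrow> \<bar>\<mu> (shift g u) - \<mu> (shift a u)\<bar> \<le> e / 3"
      by (rule functionals_orbit[OF \<mu> a e3]) (rule that)
    \<comment> \<open>Moving \<open>g\<close> with \<open>\<mu>\<close> fixed is controlled by the
      orbit condition on \<open>V'\<close>; moving the functional with \<open>g\<close> fixed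
      expands distances by at most \<open>L\<close>, uniformly for \<open>g\<close> in
      \<open>V\<close>. Uniformity in \<open>g\<close> is where the local bound on conjugation is
      indispensable.\<close>
    let ?V = "(V \<inter> V') \<times> functional.mball \<mu> (e / (3 * L))"
    have "functional_dist (functional_act a \<mu>) (functional_act g \<nu>) < e" if "(g, \<nu>) \<in> ?V" for g \<nu>
    proof -
      have g: "g \<in> V" "g \<in> V'" "g \<in> carrier G" and \<nu>: "\<nu> \<in> functionals" "functional_dist \<mu> \<nu> < e / (3 * L)"
        using that open_carrier[OF V(1)] by auto
      have "functional_dist (functional_act a \<mu>) (functional_act g \<mu>) \<le> e / 3"
      proof (rule functional_dist_le)
        fix u assume "u \<in> unit_lipschitz"
        then show "\<bar>functional_act a \<mu> u - functional_act g \<mu> u\<bar> \<le> e / 3"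
          using orbit[OF g(2), of u] by (simp add: functional_act_def unit_lipschitz_cone abs_minus_commute)
      qed
      moreover have "functional_dist (functional_act g \<mu>) (functional_act g \<nu>) \<le> L * functional_dist \<mu> \<nu>"
        by (rule functional_act_dist_le) (use g L \<mu> \<nu> in auto)
      moreover have "L * functional_dist \<mu> \<nu> < e / 3"
        using \<nu>(2) L(1) by (simp add: field_simps)
      moreover have "functional_dist (functional_act a \<mu>) (functional_act g \<nu>)
          \<le> functional_dist (functional_act a \<mu>) (functional_act g \<mu>)
            + functional_dist (functional_act g \<mu>) (functional_act g \<nu>)"
        using a g \<mu> \<nu> by (intro functional.triangle functional_act_closed)
      ultimately show ?thesis using e by linarith
    qed
    moreover have "functional_act g \<nu> \<in> functionals" if "(g, \<nu>) \<in> ?V" for g \<nu>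
      using that open_carrier[OF V(1)] by (auto intro: functional_act_closed)
    ultimately show "\<exists>V. openin (prod_topology T functional.mtopology) V \<and> p \<in> V \<and>
        (\<forall>q\<in>V. (case q of (g, \<mu>) \<Rightarrow> functional_act g \<mu>)
           \<in> functional.mball (case p of (g, \<mu>) \<Rightarrow> functional_act g \<mu>) e)"
      using p a \<mu> e L(1) V V'
      by (intro exI[of _ ?V]) (auto simp: functional_act_closed openin_prod_Times_iff)
  qed
qed

section \<open>Evaluation at the base point\<close>

definition base_evaluation :: "('g \<Rightarrow> real) \<Rightarrow> real" where
  "base_evaluation u = (if u \<in> lipschitz_cone then u \<one> else 0)"

text \<open>Its translate by \<open>g\<close> is evaluation at \<open>g\<close>, and
  \<open>\<bar>u g - u a\<bar> \<le> w (g \<otimes> inv a)\<close> for all \<open>u\<close> in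
  \<open>unit_lipschitz\<close> at once. So its orbit is norm continuous.\<close>

lemma base_evaluation_functionals: "base_evaluation \<in> functionals"
proof -
  have "\<exists>V. openin T V \<and> a \<in> V \<and> (\<forall>g\<in>V. \<forall>u\<in>unit_lipschitz.
      \<bar>base_evaluation (shift g u) - base_evaluation (shift a u)\<bar> \<le> e)"
    if a: "a \<in> carrier G" and e: "0 < e" for a e
  proof -
    obtain V where V: "openin T V" "\<one> \<in> V" "\<And>x. x \<in> V \<Longrightarrow> w x < e"
      by (rule gauge_small[OF e]) (rule that)
    obtain V1 V2 where V1: "openin T V1" "a \<in> V1" "inv a \<in> V2"
      "\<And>x y. x \<in> V1 \<Longrightarrow> y \<in> V2 \<Longrightarrow> x \<otimes> y \<in> V"
      by (rule hausdorff_group_mult_nhds[OF hausdorff V(1) a inv_closed[OF a]]) (use V a in auto)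
    have "\<bar>base_evaluation (shift g u) - base_evaluation (shift a u)\<bar> \<le> e"
      if g: "g \<in> V1" and u: "u \<in> unit_lipschitz" for g u
    proof -
      have gc: "g \<in> carrier G" by (rule open_carrier[OF V1(1) g])
      have "\<bar>u (g \<otimes> inv a \<otimes> a) - u a\<bar> \<le> w (g \<otimes> inv a)"
        using unit_lipschitzD(4)[OF u] gc a by simp
      moreover have "w (g \<otimes> inv a) < e" by (intro V(3) V1(4) g V1(3))
      moreover have "g \<otimes> inv a \<otimes> a = g" using gc a by (simp add: m_assoc)
      ultimately have "\<bar>u g - u a\<bar> \<le> e" by simp
      then show ?thesis
        using gc a u by (simp add: base_evaluation_def shift_lipschitz_cone unit_lipschitz_cone)
          (simp add: shift_def)
    qed
    then show ?thesis using V1 by blast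
  qed
  moreover have "\<bar>base_evaluation u\<bar> \<le> 1" if "u \<in> unit_lipschitz" for u
    using unit_lipschitzD(2)[OF that one_closed] by (simp add: base_evaluation_def)
  moreover have "base_evaluation (\<lambda>x. c * u x) = c * base_evaluation u"
    if "0 < c" "u \<in> lipschitz_cone" for c u
    using that by (simp add: base_evaluation_def lipschitz_cone_scale)
  moreover have "base_evaluation u = 0" if "u \<notin> lipschitz_cone" for u
    using that by (simp add: base_evaluation_def)
  ultimately show ?thesis
    unfolding functionals_def by blast
qed

lemma functional_act_base_evaluation:
  assumes "g \<in> carrier G" "u \<in> lipschitz_cone"
  shows "functional_act g base_evaluation u = u g"
  using assms shift_lipschitz_cone[OF assms]
  by (simp add: functional_act_def base_evaluation_def) (simp add: shift_def)

text \<open>Right invariance under \<open>H\<close>, applied at the unit, says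
  \<open>u h = u \<one>\<close>.\<close>

lemma functional_act_base_evaluation_H:
  assumes "h \<in> H"
  shows "functional_act h base_evaluation = base_evaluation"
proof (rule functionals_eqI)
  fix u assume u: "u \<in> unit_lipschitz"
  then show "functional_act h base_evaluation u = base_evaluation u"
    using unit_lipschitzD(3)[OF u one_closed assms] H_closed[OF assms]
    by (simp add: functional_act_base_evaluation unit_lipschitz_cone base_evaluation_def)
qed (use assms H_closed base_evaluation_functionals functional_act_closed in auto)

section \<open>A Lipschitz function separating the points outside \<open>H\<close> from the base
  point\<close>

definition word_lengths :: "'g \<Rightarrow> real set" where
  "word_lengths x = {sum_list (map w xs) |xs h. set xs \<subseteq> carrier G \<and> h \<in> H \<and> foldr (mult G) xs \<one> = x \<otimes> h}"

text \<open>The distance from the base point to \<open>x H\<close> in the pseudometric generated by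
  the gauge: the least total gauge of a word whose product lies in the coset. Words repair the
  missing subadditivity of \<open>w\<close>.\<close>

definition length_mod_H :: "'g \<Rightarrow> real" where
  "length_mod_H x = (if x \<in> carrier G then Inf (word_lengths x) else 0)"

lemma word_lengthsI:
  "set xs \<subseteq> carrier G \<Longrightarrow> h \<in> H \<Longrightarrow> foldr (mult G) xs \<one> = x \<otimes> h \<Longrightarrow> sum_list (map w xs) \<in> word_lengths x"
  by (auto simp: word_lengths_def)

lemma word_lengths_nonneg: "l \<in> word_lengths x \<Longrightarrow> 0 \<le> l"
  by (auto simp: word_lengths_def intro!: sum_list_nonneg gauge_bounds)

lemma gauge_in_word_lengths: "x \<in> carrier G \<Longrightarrow> w x \<in> word_lengths x"
  using word_lengthsI[of "[x]" "\<one>" x] subgroup.one_closed[OF H] by simp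

lemma length_mod_H_le: "x \<in> carrier G \<Longrightarrow> l \<in> word_lengths x \<Longrightarrow> length_mod_H x \<le> l"
  by (auto simp: length_mod_H_def intro!: cInf_lower bdd_belowI[of _ 0] word_lengths_nonneg)

lemma length_mod_H_ge:
  "x \<in> carrier G \<Longrightarrow> (\<And>l. l \<in> word_lengths x \<Longrightarrow> c \<le> l) \<Longrightarrow> c \<le> length_mod_H x"
  using gauge_in_word_lengths[of x] by (auto simp: length_mod_H_def intro!: cInf_greatest)

text \<open>Prepending \<open>z\<close> to a word for the coset of \<open>x\<close> gives a word for
  the coset of \<open>z \<otimes> x\<close>.\<close>

lemma length_mod_H_mult_le:
  assumes x: "x \<in> carrier G" and z: "z \<in> carrier G"
  shows "length_mod_H (z \<otimes> x) \<le> w z + length_mod_H x"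
proof -
  have "length_mod_H (z \<otimes> x) - w z \<le> length_mod_H x"
  proof (rule length_mod_H_ge[OF x])
    fix l assume "l \<in> word_lengths x"
    then obtain xs h where "l = sum_list (map w xs)" "set xs \<subseteq> carrier G" "h \<in> H" "foldr (mult G) xs \<one> = x \<otimes> h"
      by (auto simp: word_lengths_def)
    then have "w z + l \<in> word_lengths (z \<otimes> x)"
      using word_lengthsI[of "z # xs" h "z \<otimes> x"] x z H_closed by (simp add: m_assoc)
    from length_mod_H_le[OF m_closed[OF z x] this] show "length_mod_H (z \<otimes> x) - w z \<le> l"
      by simp
  qed
  then show ?thesis by simp
qed

text \<open>The reverse increment is the same inequality for the inverse of \<open>z\<close>, whose
  gauge is equal. One-letter words give the bound \<open>1\<close>, and invariance holds because
  words are compared with whole cosets.\<close>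

lemma length_mod_H_unit_lipschitz: "length_mod_H \<in> unit_lipschitz"
proof -
  have "\<bar>length_mod_H x\<bar> \<le> 1" if "x \<in> carrier G" for x
    using length_mod_H_le[OF that gauge_in_word_lengths[OF that]] gauge_bounds(2)[OF that]
      length_mod_H_ge[OF that, of 0] word_lengths_nonneg by force
  moreover have "length_mod_H (x \<otimes> h) = length_mod_H x" if x: "x \<in> carrier G" and h: "h \<in> H" for x h
  proof -
    have "\<exists>k\<in>H. y = x \<otimes> h \<otimes> k" if k: "k \<in> H" "y = x \<otimes> k" for y k
    proof
      show "inv h \<otimes> k \<in> H" using h k subgroup.m_inv_closed[OF H] subgroup.m_closed[OF H] by blast
      have "x \<otimes> h \<otimes> (inv h \<otimes> k) = x \<otimes> (h \<otimes> inv h) \<otimes> k"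
        using x h k H_closed by (simp only: m_assoc m_closed inv_closed)
      then show "y = x \<otimes> h \<otimes> (inv h \<otimes> k)" using x h k H_closed by simp
    qed
    moreover have "\<exists>k'\<in>H. y = x \<otimes> k'" if k: "k \<in> H" "y = x \<otimes> h \<otimes> k" for y k
      using x h k H_closed subgroup.m_closed[OF H] by (metis m_assoc)
    ultimately have "(\<exists>k\<in>H. y = x \<otimes> h \<otimes> k) \<longleftrightarrow> (\<exists>k\<in>H. y = x \<otimes> k)" for y by blast
    then have "word_lengths (x \<otimes> h) = word_lengths x"
      unfolding word_lengths_def by blast
    then show ?thesis using x h H_closed by (simp add: length_mod_H_def)
  qed
  moreover have "\<bar>length_mod_H (z \<otimes> x) - length_mod_H x\<bar> \<le> w z"
    if x: "x \<in> carrier G" and z: "z \<in> carrier G" for x z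
  proof -
    have "inv z \<otimes> (z \<otimes> x) = x" using x z by (simp add: m_assoc[symmetric])
    then have "length_mod_H x \<le> w z + length_mod_H (z \<otimes> x)"
      using length_mod_H_mult_le[of "z \<otimes> x" "inv z"] x z by (simp add: gauge_inv)
    with length_mod_H_mult_le[OF x z] show ?thesis by linarith
  qed
  ultimately show ?thesis by (auto simp: unit_lipschitz_def length_mod_H_def)
qed

lemma length_mod_H_one: "length_mod_H \<one> \<le> 0"
  using word_lengthsI[of "[]" "\<one>" "\<one>"] subgroup.one_closed[OF H] by (intro length_mod_H_le) auto

text \<open>Closedness of \<open>H\<close> gives a neighbourhood \<open>V\<close> of the unit that
  misses the coset \<open>g H\<close>: if \<open>g \<otimes> h\<close> were in \<open>V\<close>, its
  inverse times \<open>g\<close>, which is \<open>inv h\<close>, would lie outside \<open>H\<close>.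
  A word with product in the coset thus has total gauge at least the \<open>d\<close> belonging to
  \<open>V\<close>.\<close>

lemma length_mod_H_pos:
  assumes cl: "closedin T H" and g: "g \<in> carrier G" "g \<notin> H"
  shows "0 < length_mod_H g"
proof -
  have "openin T (carrier G - H)" using cl by (simp add: closedin_def topspace_G)
  then obtain V1 V2 where V1: "openin T V1" "\<one> \<in> V1" "g \<in> V2"
    "\<And>x y. x \<in> V1 \<Longrightarrow> y \<in> V2 \<Longrightarrow> x \<otimes> y \<in> carrier G - H"
    by (rule hausdorff_group_mult_nhds[OF hausdorff _ one_closed g(1)]) (use g in auto)
  obtain V where V: "openin T V" "\<one> \<in> V" "\<And>x. x \<in> V \<Longrightarrow> inv x \<in> V1"
    by (rule hausdorff_group_inv_nhds[OF hausdorff V1(1) one_closed]) (use V1 in auto)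
  obtain d where d: "0 < d"
    "\<And>xs. set xs \<subseteq> carrier G \<Longrightarrow> sum_list (map w xs) < d \<Longrightarrow> foldr (mult G) xs \<one> \<in> V"
    by (rule gauge_separates[OF V(1,2)]) (rule that)
  have "d \<le> length_mod_H g"
  proof (rule length_mod_H_ge[OF g(1)])
    fix l assume "l \<in> word_lengths g"
    then obtain xs h where xs: "l = sum_list (map w xs)" "set xs \<subseteq> carrier G" "h \<in> H"
      "foldr (mult G) xs \<one> = g \<otimes> h"
      by (auto simp: word_lengths_def)
    show "d \<le> l"
    proof (rule ccontr)
      assume "\<not> d \<le> l"
      then have "g \<otimes> h \<in> V" using d(2)[of xs] xs by simp
      then have "inv (g \<otimes> h) \<otimes> g \<notin> H" using V1(4)[OF V(3) V1(3)] by simp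
      moreover have "inv (g \<otimes> h) \<otimes> g = inv h"
        using g H_closed[OF xs(3)] by (simp add: inv_mult_group m_assoc)
      ultimately show False using subgroup.m_inv_closed[OF H xs(3)] by simp
    qed
  qed
  with d(1) show ?thesis by simp
qed

lemma closed_subgroup_not_epi:
  assumes "closedin T H" "H \<noteq> carrier G"
  shows "\<not> hausdorff_group_epi TYPE((('g \<Rightarrow> real) \<Rightarrow> real) \<times> 'g)
    (G\<lparr>carrier := H\<rparr>) (subtopology T H) G T (\<lambda>x. x)"
proof -
  obtain g where g: "g \<in> carrier G" "g \<notin> H" using assms(2) H_closed by blast
  have c: "length_mod_H \<in> lipschitz_cone"
    by (intro unit_lipschitz_cone length_mod_H_unit_lipschitz)
  have "functional_act g base_evaluation \<noteq> base_evaluation"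
  proof
    assume "functional_act g base_evaluation = base_evaluation"
    \<comment> \<open>\<open>length_mod_H\<close> is the test function: the two functionals take at
      it the values at \<open>g\<close> and at the unit.\<close>
    then have "length_mod_H g = length_mod_H \<one>"
      using functional_act_base_evaluation[OF g(1) c] c by (simp add: base_evaluation_def)
    with length_mod_H_pos[OF assms(1) g] length_mod_H_one show False by simp
  qed
  then show ?thesis
    using g by (intro functional.not_epi_if_fixed_point[OF H, of base_evaluation])
      (simp_all add: functional_group_simps base_evaluation_functionals functional_act_base_evaluation_H)
qed

end

theorem theorem6p1:
  fixes G :: "('g, 'x) monoid_scheme"
    and T :: "'g topology"
    and A :: "('g, 'e::banach) chart set"
    and H :: "'g set"
  assumes "banach_lie_group G T A"
    and "subgroup H G"
    and "closedin T H"
    and "H \<noteq> carrier G"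
  shows "\<not> hausdorff_group_epi TYPE('g words)
             (G\<lparr>carrier := H\<rparr>) (subtopology T H) G T (\<lambda>x. x) \<and>
         (\<exists>(K :: 'g words monoid) R \<phi> \<psi>.
            hausdorff_group_hom G T K R \<phi> \<and> hausdorff_group_hom G T K R \<psi> \<and>
            (\<forall>h\<in>H. \<phi> h = \<psi> h) \<and> (\<exists>g\<in>carrier G. \<phi> g \<noteq> \<psi> g))"
proof -
  have G: "hausdorff_group G T" by (rule banach_lie_group_imp_hausdorff_group[OF assms(1)])
  then interpret group G by (simp add: hausdorff_group_def)
  obtain w where "conjugation_gauge G T w"
    using banach_lie_group_conjugation_gauge[OF assms(1)] .
  then interpret gauged_group G T w H
    by (intro gauged_group.intro gauged_group_axioms.intro is_group G assms(2))
  \<comment> \<open>The semidirect product lives on the type of pairs of a functional and a group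
    element. The universality of \<open>'g words\<close> as a type of test objects transfers the
    failure.\<close>
  have not_epi: "\<not> hausdorff_group_epi TYPE('g words) (G\<lparr>carrier := H\<rparr>) (subtopology T H) G T (\<lambda>x. x)"
    using closed_subgroup_not_epi[OF assms(3,4)] hausdorff_group_epi_universal by blast
  have mult_cont: "continuous_map (prod_topology T T) T (\<lambda>(x, y). x \<otimes>\<^bsub>G\<^esub> y)"
    and inv_cont: "continuous_map T T (\<lambda>x. inv\<^bsub>G\<^esub> x)" and HT: "Hausdorff_space T"
    using G by (auto simp: hausdorff_group_def)
  \<comment> \<open>An inclusion that was not a morphism would fail to be an epimorphism for a
    trivial reason. Once \<open>H\<close> is shown to be a Hausdorff group and the inclusion a
    morphism, the failure can only come from two distinct morphisms that agree on
    \<open>H\<close>.\<close>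
  have tH: "topspace (subtopology T H) = H"
    using H_closed by (auto simp: topspace_G)
  have "continuous_map (subtopology T H) (subtopology T H) (\<lambda>x. inv\<^bsub>G\<^esub> x)"
    using continuous_map_from_subtopology[OF inv_cont] subgroup.m_inv_closed[OF assms(2)]
    by (auto simp: continuous_map_in_subtopology)
  then have "continuous_map (subtopology T H) (subtopology T H) (\<lambda>x. inv\<^bsub>G\<lparr>carrier := H\<rparr>\<^esub> x)"
    by (rule continuous_map_eq) (use assms(2) in \<open>simp add: tH m_inv_consistent\<close>)
  moreover have "continuous_map (prod_topology (subtopology T H) (subtopology T H)) (subtopology T H)
      (\<lambda>(x, y). x \<otimes>\<^bsub>G\<^esub> y)"
    using continuous_map_from_subtopology[OF mult_cont, of "H \<times> H"] subgroup.m_closed[OF assms(2)]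
    by (auto simp: continuous_map_in_subtopology subtopology_Times)
  ultimately have "hausdorff_group (G\<lparr>carrier := H\<rparr>) (subtopology T H)"
    using subgroup.subgroup_is_group[OF assms(2) is_group] HT tH
    by (simp add: hausdorff_group_def Hausdorff_space_subtopology)
  then have "hausdorff_group_hom (G\<lparr>carrier := H\<rparr>) (subtopology T H) G T (\<lambda>x. x)"
    using G H_closed continuous_map_from_subtopology[OF continuous_map_id]
    by (auto simp: hausdorff_group_hom_def hom_def id_def)
  with not_epi show ?thesis
    by (auto simp: hausdorff_group_epi_def)
qed

end
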